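(* The mate correspondences for companions and for conjunctions are preserved by double pseudofunctors. Precisely, let $F\colon\mathsf K\to\mathsf L$ be a double pseudofunctor. (Companions) Let $f,g$ be vertical 1-cells of $\mathsf K$ with horizontal companions $f',g'$. If squares $\alpha$ (top $j$, left $fi$, right $mg$, bottom $n$) and $\beta$ (top $g'j$, left $i$, right $m$, bottom $nf'$) in $\mathsf K$ are mates, then the squares $$F^{fi}\ast_hF\alpha\ast_h(F^{mg})^{-1}\quad\text{and}\quad F_{nf'}\ast_vF\beta\ast_v(F_{g'j})^{-1}$$ in $\mathsf L$ are mates with respect to the induced companion pairs $(Ff,Ff')$ and $(Fg,Fg')$. (Conjunctions) Let $f,h$ be vertical 1-cells of $\mathsf K$ with right conjoints $g,k$. If squares $\alpha$ (top $i$, left $mh$, right $fj$, bottom $n$) and $\beta$ (top $ik$, left $m$, right $j$, bottom $gn$) in $\mathsf K$ are mates, then $$F^{mh}\ast_hF\alpha\ast_h(F^{fj})^{-1}\quad\text{and}\quad F_{gn}\ast_vF\beta\ast_v(F_{ik})^{-1}$$ in $\mathsf L$ are mates with respect to the induced conjunctions $(Ff,Fg)$ and $(Fh,Fk)$.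
   Context: **Double categories.** A double category $\mathsf K$ has objects; two categories with these objects, whose arrows are called vertical and horizontal 1-cells; and squares with boundary: top horizontal $f\colon a\to c$, left vertical $h\colon a\to b$, right vertical $k\colon c\to d$, bottom horizontal $g\colon b\to d$. Squares compose horizontally, $\alpha\ast_h\beta$ ($\alpha$ on the left), and vertically, $\beta\ast_v\alpha$ ($\alpha$ on top), associatively and unitally and with interchange. The vertical and horizontal identities of $a$ are $1_a$ and $1^a$. A vertical $u$ has identity square $1^u$ (left and right $u$), and a horizontal $f$ has identity square $1_f$ (top and bottom $f$), with the usual compatibilities. A square is h-globular if its left and right sides are identities, and v-globular if its top and bottom sides are identities. **Companions, conjunctions, mates.** A companion pair consists of a vertical $f\colon a\to b$, a horizontal $f'\colon a\to b$, and squares $\varphi$ (top $f'$, left $f$, right $1_b$, bottom $1^b$) and $\psi$ (top $1^a$, left $1_a$, right $f$, bottom $f'$) with $\varphi\ast_v\psi=1^f$, $\psi\ast_h\varphi=1_{f'}$. A conjunction consists of a vertical $f\colon a\to b$, a horizontal $g\colon b\to a$, and squares $\eta$ (top $1^a$, left $f$, right $1_a$, bottom $g$) and $\varepsilon$ (top $g$, left $1_b$, right $f$, bottom $1^b$) with $\varepsilon\ast_h\eta=1_g$, $\varepsilon\ast_v\eta=1^f$; $g$ is a right conjoint of $f$. For companions, $\alpha$ (top $j$, left $fi$, right $mg$, bottom $n$) and $\beta$ (top $g'j$, left $i$, right $m$, bottom $nf'$) are mates if $\beta=(\psi_f\ast_v1^i)\ast_h\alpha\ast_h(1^m\ast_v\varphi_g)$,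 equivalently $\alpha=(\varphi_f\ast_h1_n)\ast_v\beta\ast_v(1_j\ast_h\psi_g)$. For conjunctions $(f,g)$ and $(h,k)$, $\alpha$ (top $i$, left $mh$, right $fj$, bottom $n$) and $\beta$ (top $ik$, left $m$, right $j$, bottom $gn$) are mates if $\beta=(1^m\ast_v\varepsilon_h)\ast_h\alpha\ast_h(\eta_f\ast_v1^j)$, equivalently $\alpha=(1_n\ast_h\varepsilon_f)\ast_v\beta\ast_v(\eta_h\ast_h1_i)$. **Double pseudofunctors.** A double pseudofunctor $F\colon\mathsf K\to\mathsf L$ consists of functions on objects, vertical 1-cells, horizontal 1-cells and squares preserving boundaries, together with invertible squares: - h-globular $F_a$ (top $F(1^a)$, bottom $1^{Fa}$) and v-globular $F^a$ (left $1_{Fa}$, right $F(1_a)$) for each object $a$; - v-globular $F^{gf}$ (left $Fg\circ Ff$, right $F(gf)$) for vertical $a\xrightarrow{f}b\xrightarrow{g}c$; - h-globular $F_{kh}$ (top $F(kh)$, bottom $Fk\circ Fh$) for horizontal $a\xrightarrow{h}b\xrightarrow{k}c$. The axioms are the following. - Vertical coherence: $(1^{Fh}\ast_v F^{gf})\ast_h F^{h(gf)}=(F^{hg}\ast_v1^{Ff})\ast_hF^{(hg)f}$, $(F^b\ast_v1^{Ff})\ast_hF^{1_bf}=1^{Ff}$, $(1^{Ff}\ast_vF^a)\ast_hF^{f1_a}=1^{Ff}$. - Horizontal coherence: $(F_{gf}\ast_h1_{Fh})\ast_vF_{h(gf)}=(1_{Ff}\ast_hF_{hg})\ast_vF_{(hg)f}$,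 $(F_a\ast_h1_{Ff})\ast_vF_{f1^a}=1_{Ff}$, $(1_{Ff}\ast_hF_b)\ast_vF_{1^bf}=1_{Ff}$. - Double naturality: $(F\alpha\ast_hF\beta)\ast_vF_{gf}=F_{kh}\ast_vF(\alpha\ast_h\beta)$ for horizontally composable $\alpha$ (top $f$, bottom $h$) and $\beta$ (top $g$, bottom $k$); $F_b\ast_vF(1^f)\ast_vF_a^{-1}=1^{Ff}$ for vertical $f\colon a\to b$; $F^{vu}\ast_hF(\beta\ast_v\alpha)=(F\beta\ast_vF\alpha)\ast_hF^{xw}$ for $\alpha$ (left $u$, right $w$) above $\beta$ (left $v$, right $x$); $F^a\ast_hF(1_f)\ast_h(F^b)^{-1}=1_{Ff}$ for horizontal $f\colon a\to b$. **Induced structures.** For a companion pair $(f,f',\varphi,\psi)$ with $f\colon a\to b$, the induced companion pair $(Ff,Ff')$ has squares $F_b\ast_v(F\varphi\ast_h(F^b)^{-1})$ and $(F^a\ast_hF\psi)\ast_vF_a^{-1}$. For a conjunction $(f,g,\eta,\varepsilon)$ with $f\colon a\to b$, the induced conjunction $(Ff,Fg)$ has unit $(F\eta\ast_h(F^a)^{-1})\ast_vF_a^{-1}$ and counit $F_b\ast_v(F^b\ast_hF\varepsilon)$. (These are known to be a companion pair and a conjunction.) *)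

theory Defs
  imports Main
begin

section \<open>Double categories\<close>

locale category =
  fixes Ob :: "'a set" and Arr :: "'b set"
    and dm cd :: "'b \<Rightarrow> 'a" and idn :: "'a \<Rightarrow> 'b" and cmp :: "'b \<Rightarrow> 'b \<Rightarrow> 'b"
  assumes dm_closed: "x \<in> Arr \<Longrightarrow> dm x \<in> Ob"
    and cd_closed: "x \<in> Arr \<Longrightarrow> cd x \<in> Ob"
    and idn_closed: "a \<in> Ob \<Longrightarrow> idn a \<in> Arr"
    and dm_idn: "a \<in> Ob \<Longrightarrow> dm (idn a) = a"
    and cd_idn: "a \<in> Ob \<Longrightarrow> cd (idn a) = a"
    and cmp_closed: "\<lbrakk>x \<in> Arr; y \<in> Arr; cd x = dm y\<rbrakk> \<Longrightarrow> cmp y x \<in> Arr"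
    and dm_cmp: "\<lbrakk>x \<in> Arr; y \<in> Arr; cd x = dm y\<rbrakk> \<Longrightarrow> dm (cmp y x) = dm x"
    and cd_cmp: "\<lbrakk>x \<in> Arr; y \<in> Arr; cd x = dm y\<rbrakk> \<Longrightarrow> cd (cmp y x) = cd y"
    and cmp_idn_right: "x \<in> Arr \<Longrightarrow> cmp x (idn (dm x)) = x"
    and cmp_idn_left: "x \<in> Arr \<Longrightarrow> cmp (idn (cd x)) x = x"
    and cmp_assoc: "\<lbrakk>x \<in> Arr; y \<in> Arr; z \<in> Arr; cd x = dm y; cd y = dm z\<rbrakk>
                      \<Longrightarrow> cmp z (cmp y x) = cmp (cmp z y) x"

text \<open>
  For an object \<open>a\<close>, \<open>ver_id a\<close> is the vertical identity \<open>1_a\<close> and \<open>hor_id a\<close> the horizontal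
  identity \<open>1^a\<close>.  For a vertical 1-cell \<open>u\<close>, \<open>sq_ver u\<close> is the identity square \<open>1^u\<close>, with left
  and right edge \<open>u\<close>; for a horizontal 1-cell \<open>f\<close>, \<open>sq_hor f\<close> is the identity square \<open>1_f\<close>, with
  top and bottom edge \<open>f\<close>.  In \<open>g \<circ>\<^sub>v f\<close> and \<open>g \<circ>\<^sub>h f\<close> the 1-cell \<open>f\<close> comes first; in
  \<open>\<alpha> \<ast>\<^sub>h \<beta>\<close> the square \<open>\<alpha>\<close> is on the left; in \<open>\<beta> \<ast>\<^sub>v \<alpha>\<close> the square \<open>\<alpha>\<close> is on top.
  All operations are total functions, constrained only on the carriers.
\<close>

record ('o, 'v, 'h, 's) dcat =
  Obj :: "'o set"
  Ver :: "'v set"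
  Hor :: "'h set"
  Sqr :: "'s set"
  ver_dom :: "'v \<Rightarrow> 'o"
  ver_cod :: "'v \<Rightarrow> 'o"
  hor_dom :: "'h \<Rightarrow> 'o"
  hor_cod :: "'h \<Rightarrow> 'o"
  ver_id :: "'o \<Rightarrow> 'v"
  hor_id :: "'o \<Rightarrow> 'h"
  ver_comp :: "'v \<Rightarrow> 'v \<Rightarrow> 'v"  (infixl "\<circ>\<^sub>v\<index>" 75)
  hor_comp :: "'h \<Rightarrow> 'h \<Rightarrow> 'h"  (infixl "\<circ>\<^sub>h\<index>" 75)
  top_edge :: "'s \<Rightarrow> 'h"
  left_edge :: "'s \<Rightarrow> 'v"
  right_edge :: "'s \<Rightarrow> 'v"
  bottom_edge :: "'s \<Rightarrow> 'h"
  sq_ver :: "'v \<Rightarrow> 's"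
  sq_hor :: "'h \<Rightarrow> 's"
  sq_hcomp :: "'s \<Rightarrow> 's \<Rightarrow> 's"  (infixl "\<ast>\<^sub>h\<index>" 70)
  sq_vcomp :: "'s \<Rightarrow> 's \<Rightarrow> 's"  (infixl "\<ast>\<^sub>v\<index>" 70)

text \<open>
  Squares form a category under \<open>\<ast>\<^sub>h\<close> with vertical 1-cells as objects, and a category under
  \<open>\<ast>\<^sub>v\<close> with horizontal 1-cells as objects.  The argument swap in the former is because \<open>\<ast>\<^sub>h\<close>
  is written in diagrammatic order.
\<close>

locale double_category =
  fixes K :: "('o, 'v, 'h, 's) dcat" (structure)
  assumes ver_category:
      "category (Obj K) (Ver K) (ver_dom K) (ver_cod K) (ver_id K) (ver_comp K)"
    and hor_category:
      "category (Obj K) (Hor K) (hor_dom K) (hor_cod K) (hor_id K) (hor_comp K)"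
    and sq_hcomp_category:
      "category (Ver K) (Sqr K) (left_edge K) (right_edge K) (sq_ver K) (\<lambda>\<beta> \<alpha>. \<alpha> \<ast>\<^sub>h \<beta>)"
    and sq_vcomp_category:
      "category (Hor K) (Sqr K) (top_edge K) (bottom_edge K) (sq_hor K) (\<lambda>\<beta> \<alpha>. \<beta> \<ast>\<^sub>v \<alpha>)"
    and corner_top_left: "\<alpha> \<in> Sqr K \<Longrightarrow> hor_dom K (top_edge K \<alpha>) = ver_dom K (left_edge K \<alpha>)"
    and corner_top_right: "\<alpha> \<in> Sqr K \<Longrightarrow> hor_cod K (top_edge K \<alpha>) = ver_dom K (right_edge K \<alpha>)"
    and corner_bottom_left: "\<alpha> \<in> Sqr K \<Longrightarrow> hor_dom K (bottom_edge K \<alpha>) = ver_cod K (left_edge K \<alpha>)"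
    and corner_bottom_right: "\<alpha> \<in> Sqr K \<Longrightarrow> hor_cod K (bottom_edge K \<alpha>) = ver_cod K (right_edge K \<alpha>)"
    and top_sq_ver: "u \<in> Ver K \<Longrightarrow> top_edge K (sq_ver K u) = hor_id K (ver_dom K u)"
    and bottom_sq_ver: "u \<in> Ver K \<Longrightarrow> bottom_edge K (sq_ver K u) = hor_id K (ver_cod K u)"
    and left_sq_hor: "f \<in> Hor K \<Longrightarrow> left_edge K (sq_hor K f) = ver_id K (hor_dom K f)"
    and right_sq_hor: "f \<in> Hor K \<Longrightarrow> right_edge K (sq_hor K f) = ver_id K (hor_cod K f)"
    and top_hcomp: "\<lbrakk>\<alpha> \<in> Sqr K; \<beta> \<in> Sqr K; right_edge K \<alpha> = left_edge K \<beta>\<rbrakk>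
      \<Longrightarrow> top_edge K (\<alpha> \<ast>\<^sub>h \<beta>) = top_edge K \<beta> \<circ>\<^sub>h top_edge K \<alpha>"
    and bottom_hcomp: "\<lbrakk>\<alpha> \<in> Sqr K; \<beta> \<in> Sqr K; right_edge K \<alpha> = left_edge K \<beta>\<rbrakk>
      \<Longrightarrow> bottom_edge K (\<alpha> \<ast>\<^sub>h \<beta>) = bottom_edge K \<beta> \<circ>\<^sub>h bottom_edge K \<alpha>"
    and left_vcomp: "\<lbrakk>\<alpha> \<in> Sqr K; \<beta> \<in> Sqr K; bottom_edge K \<alpha> = top_edge K \<beta>\<rbrakk>
      \<Longrightarrow> left_edge K (\<beta> \<ast>\<^sub>v \<alpha>) = left_edge K \<beta> \<circ>\<^sub>v left_edge K \<alpha>"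
    and right_vcomp: "\<lbrakk>\<alpha> \<in> Sqr K; \<beta> \<in> Sqr K; bottom_edge K \<alpha> = top_edge K \<beta>\<rbrakk>
      \<Longrightarrow> right_edge K (\<beta> \<ast>\<^sub>v \<alpha>) = right_edge K \<beta> \<circ>\<^sub>v right_edge K \<alpha>"
    and sq_ver_comp: "\<lbrakk>u \<in> Ver K; v \<in> Ver K; ver_cod K u = ver_dom K v\<rbrakk>
      \<Longrightarrow> sq_ver K (v \<circ>\<^sub>v u) = sq_ver K v \<ast>\<^sub>v sq_ver K u"
    and sq_hor_comp: "\<lbrakk>f \<in> Hor K; g \<in> Hor K; hor_cod K f = hor_dom K g\<rbrakk>
      \<Longrightarrow> sq_hor K (g \<circ>\<^sub>h f) = sq_hor K f \<ast>\<^sub>h sq_hor K g"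
    and sq_id: "a \<in> Obj K \<Longrightarrow> sq_ver K (ver_id K a) = sq_hor K (hor_id K a)"
    and interchange:
      "\<lbrakk>\<alpha> \<in> Sqr K; \<beta> \<in> Sqr K; \<gamma> \<in> Sqr K; \<delta> \<in> Sqr K;
        right_edge K \<alpha> = left_edge K \<beta>; right_edge K \<gamma> = left_edge K \<delta>;
        bottom_edge K \<alpha> = top_edge K \<gamma>; bottom_edge K \<beta> = top_edge K \<delta>\<rbrakk>
      \<Longrightarrow> (\<gamma> \<ast>\<^sub>h \<delta>) \<ast>\<^sub>v (\<alpha> \<ast>\<^sub>h \<beta>) = (\<gamma> \<ast>\<^sub>v \<alpha>) \<ast>\<^sub>h (\<delta> \<ast>\<^sub>v \<beta>)"

text \<open>Boundaries are listed in the order top, left, right, bottom.\<close>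

definition square :: "('o, 'v, 'h, 's) dcat \<Rightarrow> 's \<Rightarrow> 'h \<Rightarrow> 'v \<Rightarrow> 'v \<Rightarrow> 'h \<Rightarrow> bool" where
  "square K \<alpha> t l r b \<longleftrightarrow> \<alpha> \<in> Sqr K \<and> top_edge K \<alpha> = t \<and> left_edge K \<alpha> = l
     \<and> right_edge K \<alpha> = r \<and> bottom_edge K \<alpha> = b"

definition h_globular :: "('o, 'v, 'h, 's) dcat \<Rightarrow> 's \<Rightarrow> bool" where
  "h_globular K \<alpha> \<longleftrightarrow> \<alpha> \<in> Sqr K
     \<and> left_edge K \<alpha> \<in> ver_id K ` Obj K \<and> right_edge K \<alpha> \<in> ver_id K ` Obj K"

definition v_globular :: "('o, 'v, 'h, 's) dcat \<Rightarrow> 's \<Rightarrow> bool" where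
  "v_globular K \<alpha> \<longleftrightarrow> \<alpha> \<in> Sqr K
     \<and> top_edge K \<alpha> \<in> hor_id K ` Obj K \<and> bottom_edge K \<alpha> \<in> hor_id K ` Obj K"

text \<open>
  Inverses with respect to \<open>\<ast>\<^sub>v\<close> are used for h-globular squares only, and inverses with respect to
  \<open>\<ast>\<^sub>h\<close> for v-globular squares only; the inverse of a globular square is then globular as well.
\<close>

definition is_vinv :: "('o, 'v, 'h, 's) dcat \<Rightarrow> 's \<Rightarrow> 's \<Rightarrow> bool" where
  "is_vinv K \<alpha> \<beta> \<longleftrightarrow> \<alpha> \<in> Sqr K \<and> \<beta> \<in> Sqr K
     \<and> top_edge K \<beta> = bottom_edge K \<alpha> \<and> bottom_edge K \<beta> = top_edge K \<alpha>
     \<and> \<beta> \<ast>\<^sub>v\<^bsub>K\<^esub> \<alpha> = sq_hor K (top_edge K \<alpha>) \<and> \<alpha> \<ast>\<^sub>v\<^bsub>K\<^esub> \<beta> = sq_hor K (bottom_edge K \<alpha>)"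

definition is_hinv :: "('o, 'v, 'h, 's) dcat \<Rightarrow> 's \<Rightarrow> 's \<Rightarrow> bool" where
  "is_hinv K \<alpha> \<beta> \<longleftrightarrow> \<alpha> \<in> Sqr K \<and> \<beta> \<in> Sqr K
     \<and> left_edge K \<beta> = right_edge K \<alpha> \<and> right_edge K \<beta> = left_edge K \<alpha>
     \<and> \<alpha> \<ast>\<^sub>h\<^bsub>K\<^esub> \<beta> = sq_ver K (left_edge K \<alpha>) \<and> \<beta> \<ast>\<^sub>h\<^bsub>K\<^esub> \<alpha> = sq_ver K (right_edge K \<alpha>)"

definition vinv :: "('o, 'v, 'h, 's) dcat \<Rightarrow> 's \<Rightarrow> 's" where
  "vinv K \<alpha> = (THE \<beta>. is_vinv K \<alpha> \<beta>)"

definition hinv :: "('o, 'v, 'h, 's) dcat \<Rightarrow> 's \<Rightarrow> 's" where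
  "hinv K \<alpha> = (THE \<beta>. is_hinv K \<alpha> \<beta>)"


section \<open>Companions, conjunctions and mates\<close>

record ('v, 'h, 's) companion =
  cpn_ver :: 'v
  cpn_hor :: 'h
  cpn_phi :: 's
  cpn_psi :: 's

definition companion_pair ::
  "('o, 'v, 'h, 's) dcat \<Rightarrow> ('v, 'h, 's) companion \<Rightarrow> bool" where
  "companion_pair K C \<longleftrightarrow>
     (let f = cpn_ver C; f' = cpn_hor C; \<phi> = cpn_phi C; \<psi> = cpn_psi C;
          a = ver_dom K f; b = ver_cod K f
      in f \<in> Ver K \<and> f' \<in> Hor K \<and> hor_dom K f' = a \<and> hor_cod K f' = b
         \<and> square K \<phi> f' f (ver_id K b) (hor_id K b)
         \<and> square K \<psi> (hor_id K a) (ver_id K a) f f'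
         \<and> \<phi> \<ast>\<^sub>v\<^bsub>K\<^esub> \<psi> = sq_ver K f
         \<and> \<psi> \<ast>\<^sub>h\<^bsub>K\<^esub> \<phi> = sq_hor K f')"

text \<open>The horizontal 1-cell of a conjunction is the right conjoint of its vertical 1-cell.\<close>

record ('v, 'h, 's) conjunction =
  cnj_ver :: 'v
  cnj_hor :: 'h
  cnj_unit :: 's
  cnj_counit :: 's

definition conjunction_pair ::
  "('o, 'v, 'h, 's) dcat \<Rightarrow> ('v, 'h, 's) conjunction \<Rightarrow> bool" where
  "conjunction_pair K C \<longleftrightarrow>
     (let f = cnj_ver C; g = cnj_hor C; \<eta> = cnj_unit C; \<epsilon> = cnj_counit C;
          a = ver_dom K f; b = ver_cod K f
      in f \<in> Ver K \<and> g \<in> Hor K \<and> hor_dom K g = b \<and> hor_cod K g = a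
         \<and> square K \<eta> (hor_id K a) f (ver_id K a) g
         \<and> square K \<epsilon> g (ver_id K b) f (hor_id K b)
         \<and> \<epsilon> \<ast>\<^sub>h\<^bsub>K\<^esub> \<eta> = sq_hor K g
         \<and> \<epsilon> \<ast>\<^sub>v\<^bsub>K\<^esub> \<eta> = sq_ver K f)"

text \<open>
  The 1-cells \<open>i\<close>, \<open>j\<close>, \<open>m\<close>, \<open>n\<close> are arguments of the mate relations because a 1-cell such as
  \<open>f \<circ>\<^sub>v i\<close> does not determine its factors.
\<close>

definition companion_mates ::
  "('o, 'v, 'h, 's) dcat \<Rightarrow> ('v, 'h, 's) companion \<Rightarrow> ('v, 'h, 's) companion
    \<Rightarrow> 'v \<Rightarrow> 'h \<Rightarrow> 'v \<Rightarrow> 'h \<Rightarrow> 's \<Rightarrow> 's \<Rightarrow> bool" where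
  "companion_mates K C D i j m n \<alpha> \<beta> \<longleftrightarrow>
     (let f = cpn_ver C; f' = cpn_hor C; g = cpn_ver D; g' = cpn_hor D
      in companion_pair K C \<and> companion_pair K D
         \<and> i \<in> Ver K \<and> ver_cod K i = ver_dom K f
         \<and> m \<in> Ver K \<and> ver_dom K m = ver_cod K g
         \<and> square K \<alpha> j (f \<circ>\<^sub>v\<^bsub>K\<^esub> i) (m \<circ>\<^sub>v\<^bsub>K\<^esub> g) n
         \<and> square K \<beta> (g' \<circ>\<^sub>h\<^bsub>K\<^esub> j) i m (n \<circ>\<^sub>h\<^bsub>K\<^esub> f')
         \<and> \<beta> = (cpn_psi C \<ast>\<^sub>v\<^bsub>K\<^esub> sq_ver K i) \<ast>\<^sub>h\<^bsub>K\<^esub> \<alpha> \<ast>\<^sub>h\<^bsub>K\<^esub> (sq_ver K m \<ast>\<^sub>v\<^bsub>K\<^esub> cpn_phi D))"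

definition conjunction_mates ::
  "('o, 'v, 'h, 's) dcat \<Rightarrow> ('v, 'h, 's) conjunction \<Rightarrow> ('v, 'h, 's) conjunction
    \<Rightarrow> 'h \<Rightarrow> 'v \<Rightarrow> 'v \<Rightarrow> 'h \<Rightarrow> 's \<Rightarrow> 's \<Rightarrow> bool" where
  "conjunction_mates K C D i j m n \<alpha> \<beta> \<longleftrightarrow>
     (let f = cnj_ver C; g = cnj_hor C; h = cnj_ver D; k = cnj_hor D
      in conjunction_pair K C \<and> conjunction_pair K D
         \<and> j \<in> Ver K \<and> ver_cod K j = ver_dom K f
         \<and> m \<in> Ver K \<and> ver_dom K m = ver_cod K h
         \<and> square K \<alpha> i (m \<circ>\<^sub>v\<^bsub>K\<^esub> h) (f \<circ>\<^sub>v\<^bsub>K\<^esub> j) n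
         \<and> square K \<beta> (i \<circ>\<^sub>h\<^bsub>K\<^esub> k) m j (g \<circ>\<^sub>h\<^bsub>K\<^esub> n)
         \<and> \<beta> = (sq_ver K m \<ast>\<^sub>v\<^bsub>K\<^esub> cnj_counit D) \<ast>\<^sub>h\<^bsub>K\<^esub> \<alpha> \<ast>\<^sub>h\<^bsub>K\<^esub> (cnj_unit C \<ast>\<^sub>v\<^bsub>K\<^esub> sq_ver K j))"


section \<open>Double pseudofunctors\<close>

text \<open>
  The comparison squares \<open>F_a\<close>, \<open>F^a\<close>, \<open>F^{gf}\<close>, \<open>F_{kh}\<close> are \<open>hglob_id F a\<close>, \<open>vglob_id F a\<close>,
  \<open>vglob_comp F g f\<close>, \<open>hglob_comp F k h\<close>.
\<close>

record ('o1, 'v1, 'h1, 's1, 'o2, 'v2, 'h2, 's2) dpfun =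
  on_obj :: "'o1 \<Rightarrow> 'o2"
  on_ver :: "'v1 \<Rightarrow> 'v2"
  on_hor :: "'h1 \<Rightarrow> 'h2"
  on_sqr :: "'s1 \<Rightarrow> 's2"
  hglob_id :: "'o1 \<Rightarrow> 's2"
  vglob_id :: "'o1 \<Rightarrow> 's2"
  vglob_comp :: "'v1 \<Rightarrow> 'v1 \<Rightarrow> 's2"
  hglob_comp :: "'h1 \<Rightarrow> 'h1 \<Rightarrow> 's2"

locale double_pseudofunctor =
  source: double_category K + target: double_category L
  for K :: "('o1, 'v1, 'h1, 's1) dcat"
    and L :: "('o2, 'v2, 'h2, 's2) dcat" (structure) +
  fixes F :: "('o1, 'v1, 'h1, 's1, 'o2, 'v2, 'h2, 's2) dpfun"
  assumes on_obj_closed: "a \<in> Obj K \<Longrightarrow> on_obj F a \<in> Obj L"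
    and on_ver_closed: "u \<in> Ver K \<Longrightarrow> on_ver F u \<in> Ver L"
    and on_ver_dom: "u \<in> Ver K \<Longrightarrow> ver_dom L (on_ver F u) = on_obj F (ver_dom K u)"
    and on_ver_cod: "u \<in> Ver K \<Longrightarrow> ver_cod L (on_ver F u) = on_obj F (ver_cod K u)"
    and on_hor_closed: "f \<in> Hor K \<Longrightarrow> on_hor F f \<in> Hor L"
    and on_hor_dom: "f \<in> Hor K \<Longrightarrow> hor_dom L (on_hor F f) = on_obj F (hor_dom K f)"
    and on_hor_cod: "f \<in> Hor K \<Longrightarrow> hor_cod L (on_hor F f) = on_obj F (hor_cod K f)"
    and on_sqr_square: "\<alpha> \<in> Sqr K \<Longrightarrow> square L (on_sqr F \<alpha>)
      (on_hor F (top_edge K \<alpha>)) (on_ver F (left_edge K \<alpha>))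
      (on_ver F (right_edge K \<alpha>)) (on_hor F (bottom_edge K \<alpha>))"
    \<comment> \<open>comparison squares\<close>
    and hglob_id: "a \<in> Obj K \<Longrightarrow> h_globular L (hglob_id F a)
      \<and> top_edge L (hglob_id F a) = on_hor F (hor_id K a)
      \<and> bottom_edge L (hglob_id F a) = hor_id L (on_obj F a)
      \<and> (\<exists>\<gamma>. is_vinv L (hglob_id F a) \<gamma>)"
    and vglob_id: "a \<in> Obj K \<Longrightarrow> v_globular L (vglob_id F a)
      \<and> left_edge L (vglob_id F a) = ver_id L (on_obj F a)
      \<and> right_edge L (vglob_id F a) = on_ver F (ver_id K a)
      \<and> (\<exists>\<gamma>. is_hinv L (vglob_id F a) \<gamma>)"
    and vglob_comp: "\<lbrakk>u \<in> Ver K; v \<in> Ver K; ver_cod K u = ver_dom K v\<rbrakk>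
      \<Longrightarrow> v_globular L (vglob_comp F v u)
      \<and> left_edge L (vglob_comp F v u) = on_ver F v \<circ>\<^sub>v on_ver F u
      \<and> right_edge L (vglob_comp F v u) = on_ver F (v \<circ>\<^sub>v\<^bsub>K\<^esub> u)
      \<and> (\<exists>\<gamma>. is_hinv L (vglob_comp F v u) \<gamma>)"
    and hglob_comp: "\<lbrakk>h \<in> Hor K; k \<in> Hor K; hor_cod K h = hor_dom K k\<rbrakk>
      \<Longrightarrow> h_globular L (hglob_comp F k h)
      \<and> top_edge L (hglob_comp F k h) = on_hor F (k \<circ>\<^sub>h\<^bsub>K\<^esub> h)
      \<and> bottom_edge L (hglob_comp F k h) = on_hor F k \<circ>\<^sub>h on_hor F h
      \<and> (\<exists>\<gamma>. is_vinv L (hglob_comp F k h) \<gamma>)"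
    \<comment> \<open>vertical coherence\<close>
    and ver_coherence_assoc:
      "\<lbrakk>u \<in> Ver K; v \<in> Ver K; w \<in> Ver K; ver_cod K u = ver_dom K v; ver_cod K v = ver_dom K w\<rbrakk>
      \<Longrightarrow> (sq_ver L (on_ver F w) \<ast>\<^sub>v vglob_comp F v u) \<ast>\<^sub>h vglob_comp F w (v \<circ>\<^sub>v\<^bsub>K\<^esub> u)
        = (vglob_comp F w v \<ast>\<^sub>v sq_ver L (on_ver F u)) \<ast>\<^sub>h vglob_comp F (w \<circ>\<^sub>v\<^bsub>K\<^esub> v) u"
    and ver_coherence_id_left: "u \<in> Ver K
      \<Longrightarrow> (vglob_id F (ver_cod K u) \<ast>\<^sub>v sq_ver L (on_ver F u))
            \<ast>\<^sub>h vglob_comp F (ver_id K (ver_cod K u)) u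
        = sq_ver L (on_ver F u)"
    and ver_coherence_id_right: "u \<in> Ver K
      \<Longrightarrow> (sq_ver L (on_ver F u) \<ast>\<^sub>v vglob_id F (ver_dom K u))
            \<ast>\<^sub>h vglob_comp F u (ver_id K (ver_dom K u))
        = sq_ver L (on_ver F u)"
    \<comment> \<open>horizontal coherence\<close>
    and hor_coherence_assoc:
      "\<lbrakk>f \<in> Hor K; g \<in> Hor K; h \<in> Hor K; hor_cod K f = hor_dom K g; hor_cod K g = hor_dom K h\<rbrakk>
      \<Longrightarrow> (hglob_comp F g f \<ast>\<^sub>h sq_hor L (on_hor F h)) \<ast>\<^sub>v hglob_comp F h (g \<circ>\<^sub>h\<^bsub>K\<^esub> f)
        = (sq_hor L (on_hor F f) \<ast>\<^sub>h hglob_comp F h g) \<ast>\<^sub>v hglob_comp F (h \<circ>\<^sub>h\<^bsub>K\<^esub> g) f"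
    and hor_coherence_id_right: "f \<in> Hor K
      \<Longrightarrow> (hglob_id F (hor_dom K f) \<ast>\<^sub>h sq_hor L (on_hor F f))
            \<ast>\<^sub>v hglob_comp F f (hor_id K (hor_dom K f))
        = sq_hor L (on_hor F f)"
    and hor_coherence_id_left: "f \<in> Hor K
      \<Longrightarrow> (sq_hor L (on_hor F f) \<ast>\<^sub>h hglob_id F (hor_cod K f))
            \<ast>\<^sub>v hglob_comp F (hor_id K (hor_cod K f)) f
        = sq_hor L (on_hor F f)"
    \<comment> \<open>double naturality\<close>
    and naturality_hcomp: "\<lbrakk>\<alpha> \<in> Sqr K; \<beta> \<in> Sqr K; right_edge K \<alpha> = left_edge K \<beta>\<rbrakk>
      \<Longrightarrow> (on_sqr F \<alpha> \<ast>\<^sub>h on_sqr F \<beta>) \<ast>\<^sub>v hglob_comp F (top_edge K \<beta>) (top_edge K \<alpha>)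
        = hglob_comp F (bottom_edge K \<beta>) (bottom_edge K \<alpha>) \<ast>\<^sub>v on_sqr F (\<alpha> \<ast>\<^sub>h\<^bsub>K\<^esub> \<beta>)"
    and naturality_sq_ver: "u \<in> Ver K
      \<Longrightarrow> hglob_id F (ver_cod K u) \<ast>\<^sub>v on_sqr F (sq_ver K u) \<ast>\<^sub>v vinv L (hglob_id F (ver_dom K u))
        = sq_ver L (on_ver F u)"
    and naturality_vcomp: "\<lbrakk>\<alpha> \<in> Sqr K; \<beta> \<in> Sqr K; bottom_edge K \<alpha> = top_edge K \<beta>\<rbrakk>
      \<Longrightarrow> vglob_comp F (left_edge K \<beta>) (left_edge K \<alpha>) \<ast>\<^sub>h on_sqr F (\<beta> \<ast>\<^sub>v\<^bsub>K\<^esub> \<alpha>)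
        = (on_sqr F \<beta> \<ast>\<^sub>v on_sqr F \<alpha>) \<ast>\<^sub>h vglob_comp F (right_edge K \<beta>) (right_edge K \<alpha>)"
    and naturality_sq_hor: "f \<in> Hor K
      \<Longrightarrow> vglob_id F (hor_dom K f) \<ast>\<^sub>h on_sqr F (sq_hor K f) \<ast>\<^sub>h hinv L (vglob_id F (hor_cod K f))
        = sq_hor L (on_hor F f)"

definition induced_companion ::
  "('o1, 'v1, 'h1, 's1) dcat \<Rightarrow> ('o2, 'v2, 'h2, 's2) dcat
    \<Rightarrow> ('o1, 'v1, 'h1, 's1, 'o2, 'v2, 'h2, 's2) dpfun
    \<Rightarrow> ('v1, 'h1, 's1) companion \<Rightarrow> ('v2, 'h2, 's2) companion" where
  "induced_companion K L F C =
     (let a = ver_dom K (cpn_ver C); b = ver_cod K (cpn_ver C)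
      in \<lparr> cpn_ver = on_ver F (cpn_ver C),
           cpn_hor = on_hor F (cpn_hor C),
           cpn_phi = hglob_id F b \<ast>\<^sub>v\<^bsub>L\<^esub> (on_sqr F (cpn_phi C) \<ast>\<^sub>h\<^bsub>L\<^esub> hinv L (vglob_id F b)),
           cpn_psi = (vglob_id F a \<ast>\<^sub>h\<^bsub>L\<^esub> on_sqr F (cpn_psi C)) \<ast>\<^sub>v\<^bsub>L\<^esub> vinv L (hglob_id F a) \<rparr>)"

definition induced_conjunction ::
  "('o1, 'v1, 'h1, 's1) dcat \<Rightarrow> ('o2, 'v2, 'h2, 's2) dcat
    \<Rightarrow> ('o1, 'v1, 'h1, 's1, 'o2, 'v2, 'h2, 's2) dpfun
    \<Rightarrow> ('v1, 'h1, 's1) conjunction \<Rightarrow> ('v2, 'h2, 's2) conjunction" where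
  "induced_conjunction K L F C =
     (let a = ver_dom K (cnj_ver C); b = ver_cod K (cnj_ver C)
      in \<lparr> cnj_ver = on_ver F (cnj_ver C),
           cnj_hor = on_hor F (cnj_hor C),
           cnj_unit = (on_sqr F (cnj_unit C) \<ast>\<^sub>h\<^bsub>L\<^esub> hinv L (vglob_id F a)) \<ast>\<^sub>v\<^bsub>L\<^esub> vinv L (hglob_id F a),
           cnj_counit = hglob_id F b \<ast>\<^sub>v\<^bsub>L\<^esub> (vglob_id F b \<ast>\<^sub>h\<^bsub>L\<^esub> on_sqr F (cnj_counit C)) \<rparr>)"

end

theory Submission
  imports Defs
begin

text \<open>
  Put \<open>X = \<psi>_f \<ast>\<^sub>v 1^i\<close> and \<open>Y = 1^m \<ast>\<^sub>v \<phi>_g\<close>, so that \<open>\<beta> = X \<ast>\<^sub>h \<alpha> \<ast>\<^sub>h Y\<close>.  The top of \<open>X\<close> and the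
  bottom of \<open>Y\<close> are identities.  Hence, applying \<open>F\<close> to \<open>\<beta>\<close>, all but the outer horizontal comparison
  squares are reduced by unit coherence to \<open>F_x^{-1}\<close> on top of \<open>FX\<close> and \<open>F_y\<close> below \<open>FY\<close>:
  \<open>F_{nf'} \<ast>\<^sub>v F\<beta> \<ast>\<^sub>v F_{g'j}^{-1} = (FX \<ast>\<^sub>v F_x^{-1}) \<ast>\<^sub>h F\<alpha> \<ast>\<^sub>h (F_y \<ast>\<^sub>v FY)\<close>.  Vertical naturality and
  unit coherence then turn the outer factors into \<open>(\<Psi> \<ast>\<^sub>v 1^{Fi}) \<ast>\<^sub>h F^{fi}\<close> and
  \<open>(F^{mg})^{-1} \<ast>\<^sub>h (1^{Fm} \<ast>\<^sub>v \<Phi>)\<close>, where \<open>\<Psi>\<close> and \<open>\<Phi>\<close> belong to the induced companion pairs.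

  A conjunction is a companion pair in the horizontally reversed double category, with counit \<open>\<phi>\<close> and
  unit \<open>\<psi>\<close>, and the roles of \<open>i\<close> and \<open>j\<close> are exchanged; so the second statement is the first one for
  the reversed double pseudofunctor.
\<close>

section \<open>Calculus in a double category\<close>

sublocale double_category \<subseteq> ver: category "Obj K" "Ver K" "ver_dom K" "ver_cod K" "ver_id K" "ver_comp K"
  by (rule ver_category)

sublocale double_category \<subseteq> hor: category "Obj K" "Hor K" "hor_dom K" "hor_cod K" "hor_id K" "hor_comp K"
  by (rule hor_category)

sublocale double_category \<subseteq> hsq: category "Ver K" "Sqr K" "left_edge K" "right_edge K" "sq_ver K"
    "\<lambda>\<beta> \<alpha>. \<alpha> \<ast>\<^sub>h \<beta>"
  by (rule sq_hcomp_category)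

sublocale double_category \<subseteq> vsq: category "Hor K" "Sqr K" "top_edge K" "bottom_edge K" "sq_hor K"
    "\<lambda>\<beta> \<alpha>. \<beta> \<ast>\<^sub>v \<alpha>"
  by (rule sq_vcomp_category)

context double_category
begin

section \<open>Boundary, unit and associativity laws as rewrite rules\<close>

lemmas boundary [simp] =
  ver.dm_closed ver.cd_closed ver.idn_closed ver.dm_idn ver.cd_idn ver.cmp_closed ver.dm_cmp ver.cd_cmp
  hor.dm_closed hor.cd_closed hor.idn_closed hor.dm_idn hor.cd_idn hor.cmp_closed hor.dm_cmp hor.cd_cmp
  hsq.dm_closed hsq.cd_closed hsq.idn_closed hsq.dm_idn hsq.cd_idn hsq.cmp_closed hsq.dm_cmp hsq.cd_cmp
  vsq.dm_closed vsq.cd_closed vsq.idn_closed vsq.dm_idn vsq.cd_idn vsq.cmp_closed vsq.dm_cmp vsq.cd_cmp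
  top_sq_ver bottom_sq_ver left_sq_hor right_sq_hor top_hcomp bottom_hcomp left_vcomp right_vcomp sq_id

text \<open>The boundary of the cell is a free variable tied by an equation, so that the rules still
  match an identity whose index has already been rewritten.\<close>

lemma units [simp]:
  "\<lbrakk>u \<in> Ver K; ver_dom K u = a\<rbrakk> \<Longrightarrow> u \<circ>\<^sub>v ver_id K a = u"
  "\<lbrakk>u \<in> Ver K; ver_cod K u = a\<rbrakk> \<Longrightarrow> ver_id K a \<circ>\<^sub>v u = u"
  "\<lbrakk>f \<in> Hor K; hor_dom K f = a\<rbrakk> \<Longrightarrow> f \<circ>\<^sub>h hor_id K a = f"
  "\<lbrakk>f \<in> Hor K; hor_cod K f = a\<rbrakk> \<Longrightarrow> hor_id K a \<circ>\<^sub>h f = f"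
  "\<lbrakk>\<alpha> \<in> Sqr K; left_edge K \<alpha> = u\<rbrakk> \<Longrightarrow> sq_ver K u \<ast>\<^sub>h \<alpha> = \<alpha>"
  "\<lbrakk>\<alpha> \<in> Sqr K; right_edge K \<alpha> = u\<rbrakk> \<Longrightarrow> \<alpha> \<ast>\<^sub>h sq_ver K u = \<alpha>"
  "\<lbrakk>\<alpha> \<in> Sqr K; top_edge K \<alpha> = f\<rbrakk> \<Longrightarrow> \<alpha> \<ast>\<^sub>v sq_hor K f = \<alpha>"
  "\<lbrakk>\<alpha> \<in> Sqr K; bottom_edge K \<alpha> = f\<rbrakk> \<Longrightarrow> sq_hor K f \<ast>\<^sub>v \<alpha> = \<alpha>"
  using ver.cmp_idn_right ver.cmp_idn_left hor.cmp_idn_right hor.cmp_idn_left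
    hsq.cmp_idn_right hsq.cmp_idn_left vsq.cmp_idn_right vsq.cmp_idn_left
  by auto

text \<open>As a rewrite rule, \<open>sq_id\<close> turns the horizontal unit on an identity 1-cell
  into \<open>sq_hor K (hor_id K a)\<close>, which the laws in \<open>units\<close> for
  \<ast>\<open>\<^sub>h\<close> no longer match. These rules cover that form.\<close>

lemma hcomp_sq_hor_id [simp]:
  "\<lbrakk>\<alpha> \<in> Sqr K; left_edge K \<alpha> = ver_id K a; a \<in> Obj K\<rbrakk> \<Longrightarrow> sq_hor K (hor_id K a) \<ast>\<^sub>h \<alpha> = \<alpha>"
  "\<lbrakk>\<alpha> \<in> Sqr K; right_edge K \<alpha> = ver_id K a; a \<in> Obj K\<rbrakk> \<Longrightarrow> \<alpha> \<ast>\<^sub>h sq_hor K (hor_id K a) = \<alpha>"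
  using hsq.cmp_idn_left [of \<alpha>] hsq.cmp_idn_right [of \<alpha>] by simp_all

lemma hcomp_assoc:
  "\<lbrakk>\<alpha> \<in> Sqr K; \<beta> \<in> Sqr K; \<gamma> \<in> Sqr K; right_edge K \<alpha> = left_edge K \<beta>; right_edge K \<beta> = left_edge K \<gamma>\<rbrakk>
    \<Longrightarrow> (\<alpha> \<ast>\<^sub>h \<beta>) \<ast>\<^sub>h \<gamma> = \<alpha> \<ast>\<^sub>h (\<beta> \<ast>\<^sub>h \<gamma>)"
  using hsq.cmp_assoc by blast

lemma vcomp_assoc:
  "\<lbrakk>\<alpha> \<in> Sqr K; \<beta> \<in> Sqr K; \<gamma> \<in> Sqr K; bottom_edge K \<alpha> = top_edge K \<beta>; bottom_edge K \<beta> = top_edge K \<gamma>\<rbrakk>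
    \<Longrightarrow> (\<gamma> \<ast>\<^sub>v \<beta>) \<ast>\<^sub>v \<alpha> = \<gamma> \<ast>\<^sub>v (\<beta> \<ast>\<^sub>v \<alpha>)"
  using vsq.cmp_assoc by metis

section \<open>Uniqueness, composition and boundaries of inverse squares\<close>

lemma is_vinv_unique:
  assumes "is_vinv K \<alpha> \<beta>" "is_vinv K \<alpha> \<gamma>"
  shows "\<beta> = \<gamma>"
proof -
  have "\<beta> = (\<gamma> \<ast>\<^sub>v \<alpha>) \<ast>\<^sub>v \<beta>"
    using assms by (simp add: is_vinv_def)
  also have "\<dots> = \<gamma> \<ast>\<^sub>v (\<alpha> \<ast>\<^sub>v \<beta>)"
    using assms by (intro vcomp_assoc) (simp_all add: is_vinv_def)
  also have "\<dots> = \<gamma>"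
    using assms by (simp add: is_vinv_def)
  finally show ?thesis .
qed

lemma is_hinv_unique:
  assumes "is_hinv K \<alpha> \<beta>" "is_hinv K \<alpha> \<gamma>"
  shows "\<beta> = \<gamma>"
proof -
  have "\<beta> = (\<gamma> \<ast>\<^sub>h \<alpha>) \<ast>\<^sub>h \<beta>"
    using assms by (simp add: is_hinv_def)
  also have "\<dots> = \<gamma> \<ast>\<^sub>h (\<alpha> \<ast>\<^sub>h \<beta>)"
    using assms by (intro hcomp_assoc) (simp_all add: is_hinv_def)
  also have "\<dots> = \<gamma>"
    using assms by (simp add: is_hinv_def)
  finally show ?thesis .
qed

lemma vinv_eqI: "is_vinv K \<alpha> \<beta> \<Longrightarrow> vinv K \<alpha> = \<beta>"
  unfolding vinv_def by (rule the_equality) (auto intro: is_vinv_unique)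

lemma hinv_eqI: "is_hinv K \<alpha> \<beta> \<Longrightarrow> hinv K \<alpha> = \<beta>"
  unfolding hinv_def by (rule the_equality) (auto intro: is_hinv_unique)

lemma is_hinv_sym: "is_hinv K \<alpha> \<beta> \<Longrightarrow> is_hinv K \<beta> \<alpha>"
  by (auto simp: is_hinv_def)

lemma is_hinv_sq_ver: "u \<in> Ver K \<Longrightarrow> is_hinv K (sq_ver K u) (sq_ver K u)"
  by (simp add: is_hinv_def)

lemma is_hinv_hcomp:
  assumes "is_hinv K \<alpha> \<alpha>'" "is_hinv K \<beta> \<beta>'" "right_edge K \<alpha> = left_edge K \<beta>"
  shows "is_hinv K (\<alpha> \<ast>\<^sub>h \<beta>) (\<beta>' \<ast>\<^sub>h \<alpha>')"
proof -
  have "(\<alpha> \<ast>\<^sub>h \<beta>) \<ast>\<^sub>h (\<beta>' \<ast>\<^sub>h \<alpha>') = \<alpha> \<ast>\<^sub>h ((\<beta> \<ast>\<^sub>h \<beta>') \<ast>\<^sub>h \<alpha>')"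
    using assms unfolding is_hinv_def
    by (subst (1 2) hcomp_assoc) simp_all
  also have "\<dots> = sq_ver K (left_edge K \<alpha>)"
    using assms by (simp add: is_hinv_def)
  finally have 1: "(\<alpha> \<ast>\<^sub>h \<beta>) \<ast>\<^sub>h (\<beta>' \<ast>\<^sub>h \<alpha>') = sq_ver K (left_edge K \<alpha>)" .
  have "(\<beta>' \<ast>\<^sub>h \<alpha>') \<ast>\<^sub>h (\<alpha> \<ast>\<^sub>h \<beta>) = \<beta>' \<ast>\<^sub>h ((\<alpha>' \<ast>\<^sub>h \<alpha>) \<ast>\<^sub>h \<beta>)"
    using assms unfolding is_hinv_def
    by (subst (1 2) hcomp_assoc) simp_all
  also have "\<dots> = sq_ver K (right_edge K \<beta>)"
    using assms by (simp add: is_hinv_def)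
  finally show ?thesis
    using 1 assms by (simp add: is_hinv_def)
qed

text \<open>Interchange pairs each square with its own inverse, leaving a vertical composite of two
  identity squares, which is again an identity square. Together with uniqueness of inverses this
  serves to invert the vertical coherence laws.\<close>

lemma is_hinv_vcomp:
  assumes "is_hinv K \<alpha> \<alpha>'" "is_hinv K \<beta> \<beta>'"
    "bottom_edge K \<alpha> = top_edge K \<beta>" "bottom_edge K \<alpha>' = top_edge K \<beta>'"
  shows "is_hinv K (\<beta> \<ast>\<^sub>v \<alpha>) (\<beta>' \<ast>\<^sub>v \<alpha>')"
proof -
  have "(\<beta> \<ast>\<^sub>v \<alpha>) \<ast>\<^sub>h (\<beta>' \<ast>\<^sub>v \<alpha>') = (\<beta> \<ast>\<^sub>h \<beta>') \<ast>\<^sub>v (\<alpha> \<ast>\<^sub>h \<alpha>')"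
    "(\<beta>' \<ast>\<^sub>v \<alpha>') \<ast>\<^sub>h (\<beta> \<ast>\<^sub>v \<alpha>) = (\<beta>' \<ast>\<^sub>h \<beta>) \<ast>\<^sub>v (\<alpha>' \<ast>\<^sub>h \<alpha>)"
    using assms unfolding is_hinv_def by (intro interchange [symmetric]; simp)+
  moreover have "ver_cod K (left_edge K \<alpha>) = ver_dom K (left_edge K \<beta>)"
    "ver_cod K (right_edge K \<alpha>) = ver_dom K (right_edge K \<beta>)"
    using assms corner_bottom_left [of \<alpha>] corner_top_left [of \<beta>]
      corner_bottom_right [of \<alpha>] corner_top_right [of \<beta>]
    by (simp_all add: is_hinv_def)
  ultimately show ?thesis
    using assms by (simp add: is_hinv_def sq_ver_comp)
qed

text \<open>\<open>is_vinv\<close> prescribes only the top and bottom of the inverse. Its sides are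
  found from \<beta> \<ast>\<open>\<^sub>v\<close> \<alpha> being an identity square: the sides of
  this composite are identities, and those of \<alpha> drop out by the unit law.\<close>

lemma is_vinv_edges:
  assumes "is_vinv K \<alpha> \<beta>" "left_edge K \<alpha> = ver_id K a" "right_edge K \<alpha> = ver_id K b"
    "a \<in> Obj K" "b \<in> Obj K"
  shows "left_edge K \<beta> = ver_id K a" "right_edge K \<beta> = ver_id K b"
proof -
  have S: "\<alpha> \<in> Sqr K" "\<beta> \<in> Sqr K" "bottom_edge K \<alpha> = top_edge K \<beta>"
    and I: "\<beta> \<ast>\<^sub>v \<alpha> = sq_hor K (top_edge K \<alpha>)"
    using assms by (simp_all add: is_vinv_def)
  have "ver_dom K (left_edge K \<beta>) = a" "ver_dom K (right_edge K \<beta>) = b"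
    "hor_dom K (top_edge K \<alpha>) = a" "hor_cod K (top_edge K \<alpha>) = b"
    using assms S corner_bottom_left [of \<alpha>] corner_top_left [of \<beta>] corner_top_left [of \<alpha>]
      corner_bottom_right [of \<alpha>] corner_top_right [of \<beta>] corner_top_right [of \<alpha>]
    by simp_all
  then show "left_edge K \<beta> = ver_id K a" "right_edge K \<beta> = ver_id K b"
    using left_vcomp [of \<alpha> \<beta>] right_vcomp [of \<alpha> \<beta>] assms S unfolding I by simp_all
qed

text \<open>The same argument with \<alpha> \<ast>\<open>\<^sub>h\<close> \<beta>, whose top and
  bottom are identities and absorb those of \<alpha>.\<close>

lemma is_hinv_edges:
  assumes "is_hinv K \<alpha> \<beta>" "top_edge K \<alpha> = hor_id K a" "bottom_edge K \<alpha> = hor_id K b"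
    "a \<in> Obj K" "b \<in> Obj K"
  shows "top_edge K \<beta> = hor_id K a" "bottom_edge K \<beta> = hor_id K b"
proof -
  have S: "\<alpha> \<in> Sqr K" "\<beta> \<in> Sqr K" "right_edge K \<alpha> = left_edge K \<beta>"
    and I: "\<alpha> \<ast>\<^sub>h \<beta> = sq_ver K (left_edge K \<alpha>)"
    using assms by (simp_all add: is_hinv_def)
  have "hor_dom K (top_edge K \<beta>) = a" "hor_dom K (bottom_edge K \<beta>) = b"
    "ver_dom K (left_edge K \<alpha>) = a" "ver_cod K (left_edge K \<alpha>) = b"
    using assms S corner_top_right [of \<alpha>] corner_top_left [of \<beta>] corner_top_left [of \<alpha>]
      corner_bottom_right [of \<alpha>] corner_bottom_left [of \<beta>] corner_bottom_left [of \<alpha>]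
    by simp_all
  then show "top_edge K \<beta> = hor_id K a" "bottom_edge K \<beta> = hor_id K b"
    using top_hcomp [of \<alpha> \<beta>] bottom_hcomp [of \<alpha> \<beta>] assms S unfolding I by simp_all
qed

lemma h_globular_Sqr: "h_globular K \<alpha> \<Longrightarrow> \<alpha> \<in> Sqr K"
  by (simp add: h_globular_def)

text \<open>Globularity only says that each side is some identity; the corner laws determine the
  object.\<close>

lemma h_globular_edges:
  assumes "h_globular K \<alpha>"
  shows "left_edge K \<alpha> = ver_id K (hor_dom K (top_edge K \<alpha>))"
    "right_edge K \<alpha> = ver_id K (hor_cod K (top_edge K \<alpha>))"
proof -
  obtain a b where "\<alpha> \<in> Sqr K" "a \<in> Obj K" "b \<in> Obj K"
    and "left_edge K \<alpha> = ver_id K a" "right_edge K \<alpha> = ver_id K b"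
    using assms by (auto simp: h_globular_def)
  then show "left_edge K \<alpha> = ver_id K (hor_dom K (top_edge K \<alpha>))"
    "right_edge K \<alpha> = ver_id K (hor_cod K (top_edge K \<alpha>))"
    by (simp_all add: corner_top_left corner_top_right)
qed

lemma v_globular_Sqr: "v_globular K \<alpha> \<Longrightarrow> \<alpha> \<in> Sqr K"
  by (simp add: v_globular_def)

lemma v_globular_edges:
  assumes "v_globular K \<alpha>"
  shows "top_edge K \<alpha> = hor_id K (ver_dom K (left_edge K \<alpha>))"
    "bottom_edge K \<alpha> = hor_id K (ver_cod K (left_edge K \<alpha>))"
proof -
  obtain a b where "\<alpha> \<in> Sqr K" "a \<in> Obj K" "b \<in> Obj K"
    and "top_edge K \<alpha> = hor_id K a" "bottom_edge K \<alpha> = hor_id K b"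
    using assms by (auto simp: v_globular_def)
  then show "top_edge K \<alpha> = hor_id K (ver_dom K (left_edge K \<alpha>))"
    "bottom_edge K \<alpha> = hor_id K (ver_cod K (left_edge K \<alpha>))"
    by (simp_all flip: corner_top_left corner_bottom_left)
qed

end

section \<open>Comparison squares\<close>

context double_pseudofunctor
begin

declare on_obj_closed [simp] on_ver_closed [simp] on_ver_dom [simp] on_ver_cod [simp]
  on_hor_closed [simp] on_hor_dom [simp] on_hor_cod [simp]

section \<open>Boundaries and cancellation laws of the comparison squares\<close>

lemma on_sqr_boundary [simp]:
  assumes "\<alpha> \<in> Sqr K"
  shows "on_sqr F \<alpha> \<in> Sqr L"
    "top_edge L (on_sqr F \<alpha>) = on_hor F (top_edge K \<alpha>)"
    "left_edge L (on_sqr F \<alpha>) = on_ver F (left_edge K \<alpha>)"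
    "right_edge L (on_sqr F \<alpha>) = on_ver F (right_edge K \<alpha>)"
    "bottom_edge L (on_sqr F \<alpha>) = on_hor F (bottom_edge K \<alpha>)"
  using on_sqr_square [OF assms] by (simp_all add: square_def)

lemma hglob_id_boundary [simp]:
  assumes "a \<in> Obj K"
  shows "hglob_id F a \<in> Sqr L"
    "top_edge L (hglob_id F a) = on_hor F (hor_id K a)"
    "bottom_edge L (hglob_id F a) = hor_id L (on_obj F a)"
    "left_edge L (hglob_id F a) = ver_id L (on_obj F a)"
    "right_edge L (hglob_id F a) = ver_id L (on_obj F a)"
  using assms hglob_id [OF assms] by (simp_all add: target.h_globular_Sqr target.h_globular_edges)

text \<open>An inverse exists by assumption and is unique, so the description in \<open>vinv\<close>
  denotes it. The corresponding facts for the other comparison squares hold for the same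
  reason.\<close>

lemma is_vinv_hglob_id: "a \<in> Obj K \<Longrightarrow> is_vinv L (hglob_id F a) (vinv L (hglob_id F a))"
  using hglob_id target.vinv_eqI by metis

lemma vinv_hglob_id [simp]:
  assumes "a \<in> Obj K"
  shows "vinv L (hglob_id F a) \<in> Sqr L"
    "top_edge L (vinv L (hglob_id F a)) = hor_id L (on_obj F a)"
    "bottom_edge L (vinv L (hglob_id F a)) = on_hor F (hor_id K a)"
    "left_edge L (vinv L (hglob_id F a)) = ver_id L (on_obj F a)"
    "right_edge L (vinv L (hglob_id F a)) = ver_id L (on_obj F a)"
    "hglob_id F a \<ast>\<^sub>v vinv L (hglob_id F a) = sq_hor L (hor_id L (on_obj F a))"
    "vinv L (hglob_id F a) \<ast>\<^sub>v hglob_id F a = sq_hor L (on_hor F (hor_id K a))"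
  using assms is_vinv_hglob_id [OF assms] target.is_vinv_edges [OF is_vinv_hglob_id [OF assms]]
  by (simp_all add: is_vinv_def)

lemma vglob_id_boundary [simp]:
  assumes "a \<in> Obj K"
  shows "vglob_id F a \<in> Sqr L"
    "top_edge L (vglob_id F a) = hor_id L (on_obj F a)"
    "bottom_edge L (vglob_id F a) = hor_id L (on_obj F a)"
    "left_edge L (vglob_id F a) = ver_id L (on_obj F a)"
    "right_edge L (vglob_id F a) = on_ver F (ver_id K a)"
  using assms vglob_id [OF assms] by (simp_all add: target.v_globular_Sqr target.v_globular_edges)

lemma is_hinv_vglob_id: "a \<in> Obj K \<Longrightarrow> is_hinv L (vglob_id F a) (hinv L (vglob_id F a))"
  using vglob_id target.hinv_eqI by metis

lemma hinv_vglob_id [simp]: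
  assumes "a \<in> Obj K"
  shows "hinv L (vglob_id F a) \<in> Sqr L"
    "top_edge L (hinv L (vglob_id F a)) = hor_id L (on_obj F a)"
    "bottom_edge L (hinv L (vglob_id F a)) = hor_id L (on_obj F a)"
    "left_edge L (hinv L (vglob_id F a)) = on_ver F (ver_id K a)"
    "right_edge L (hinv L (vglob_id F a)) = ver_id L (on_obj F a)"
    "vglob_id F a \<ast>\<^sub>h hinv L (vglob_id F a) = sq_ver L (ver_id L (on_obj F a))"
    "hinv L (vglob_id F a) \<ast>\<^sub>h vglob_id F a = sq_ver L (on_ver F (ver_id K a))"
  using assms is_hinv_vglob_id [OF assms] target.is_hinv_edges [OF is_hinv_vglob_id [OF assms]]
  by (simp_all add: is_hinv_def)

lemma vglob_comp_boundary [simp]: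
  assumes "u \<in> Ver K" "v \<in> Ver K" "ver_cod K u = ver_dom K v"
  shows "vglob_comp F v u \<in> Sqr L"
    "top_edge L (vglob_comp F v u) = hor_id L (on_obj F (ver_dom K u))"
    "bottom_edge L (vglob_comp F v u) = hor_id L (on_obj F (ver_cod K v))"
    "left_edge L (vglob_comp F v u) = on_ver F v \<circ>\<^sub>v on_ver F u"
    "right_edge L (vglob_comp F v u) = on_ver F (v \<circ>\<^sub>v\<^bsub>K\<^esub> u)"
  using assms vglob_comp [OF assms] by (simp_all add: target.v_globular_Sqr target.v_globular_edges)

lemma is_hinv_vglob_comp:
  "\<lbrakk>u \<in> Ver K; v \<in> Ver K; ver_cod K u = ver_dom K v\<rbrakk>
    \<Longrightarrow> is_hinv L (vglob_comp F v u) (hinv L (vglob_comp F v u))"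
  using vglob_comp target.hinv_eqI by metis

lemma hinv_vglob_comp [simp]:
  assumes "u \<in> Ver K" "v \<in> Ver K" "ver_cod K u = ver_dom K v"
  shows "hinv L (vglob_comp F v u) \<in> Sqr L"
    "top_edge L (hinv L (vglob_comp F v u)) = hor_id L (on_obj F (ver_dom K u))"
    "bottom_edge L (hinv L (vglob_comp F v u)) = hor_id L (on_obj F (ver_cod K v))"
    "left_edge L (hinv L (vglob_comp F v u)) = on_ver F (v \<circ>\<^sub>v\<^bsub>K\<^esub> u)"
    "right_edge L (hinv L (vglob_comp F v u)) = on_ver F v \<circ>\<^sub>v on_ver F u"
    "vglob_comp F v u \<ast>\<^sub>h hinv L (vglob_comp F v u) = sq_ver L (on_ver F v \<circ>\<^sub>v on_ver F u)"
    "hinv L (vglob_comp F v u) \<ast>\<^sub>h vglob_comp F v u = sq_ver L (on_ver F (v \<circ>\<^sub>v\<^bsub>K\<^esub> u))"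
  using assms is_hinv_vglob_comp [OF assms] target.is_hinv_edges [OF is_hinv_vglob_comp [OF assms]]
  by (simp_all add: is_hinv_def)

lemma hglob_comp_boundary [simp]:
  assumes "h \<in> Hor K" "k \<in> Hor K" "hor_cod K h = hor_dom K k"
  shows "hglob_comp F k h \<in> Sqr L"
    "top_edge L (hglob_comp F k h) = on_hor F (k \<circ>\<^sub>h\<^bsub>K\<^esub> h)"
    "bottom_edge L (hglob_comp F k h) = on_hor F k \<circ>\<^sub>h on_hor F h"
    "left_edge L (hglob_comp F k h) = ver_id L (on_obj F (hor_dom K h))"
    "right_edge L (hglob_comp F k h) = ver_id L (on_obj F (hor_cod K k))"
  using assms hglob_comp [OF assms] by (simp_all add: target.h_globular_Sqr target.h_globular_edges)

lemma is_vinv_hglob_comp: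
  "\<lbrakk>h \<in> Hor K; k \<in> Hor K; hor_cod K h = hor_dom K k\<rbrakk>
    \<Longrightarrow> is_vinv L (hglob_comp F k h) (vinv L (hglob_comp F k h))"
  using hglob_comp target.vinv_eqI by metis

lemma vinv_hglob_comp [simp]:
  assumes "h \<in> Hor K" "k \<in> Hor K" "hor_cod K h = hor_dom K k"
  shows "vinv L (hglob_comp F k h) \<in> Sqr L"
    "top_edge L (vinv L (hglob_comp F k h)) = on_hor F k \<circ>\<^sub>h on_hor F h"
    "bottom_edge L (vinv L (hglob_comp F k h)) = on_hor F (k \<circ>\<^sub>h\<^bsub>K\<^esub> h)"
    "left_edge L (vinv L (hglob_comp F k h)) = ver_id L (on_obj F (hor_dom K h))"
    "right_edge L (vinv L (hglob_comp F k h)) = ver_id L (on_obj F (hor_cod K k))"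
    "hglob_comp F k h \<ast>\<^sub>v vinv L (hglob_comp F k h) = sq_hor L (on_hor F k \<circ>\<^sub>h on_hor F h)"
    "vinv L (hglob_comp F k h) \<ast>\<^sub>v hglob_comp F k h = sq_hor L (on_hor F (k \<circ>\<^sub>h\<^bsub>K\<^esub> h))"
  using assms is_vinv_hglob_comp [OF assms] target.is_vinv_edges [OF is_vinv_hglob_comp [OF assms]]
  by (simp_all add: is_vinv_def)

text \<open>Unit coherence makes \<open>hglob_id F a \<ast>\<^sub>h sq_hor L (on_hor F f)\<close> a
  vertical left inverse of this comparison square. That left inverse is itself invertible by
  interchange, and cancelling it leaves the whiskered inverse of \<open>hglob_id F a\<close>.
  Comparison squares at an identity can thereby be eliminated from naturality.\<close>

lemma hglob_comp_id_right:
  assumes "f \<in> Hor K" "hor_dom K f = a"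
  shows "hglob_comp F f (hor_id K a) = vinv L (hglob_id F a) \<ast>\<^sub>h sq_hor L (on_hor F f)"
proof -
  have a: "a \<in> Obj K" using assms by auto
  have "(vinv L (hglob_id F a) \<ast>\<^sub>h sq_hor L (on_hor F f)) \<ast>\<^sub>v (hglob_id F a \<ast>\<^sub>h sq_hor L (on_hor F f))
      = sq_hor L (on_hor F f \<circ>\<^sub>h on_hor F (hor_id K a))"
    using assms a by (simp add: target.interchange target.sq_hor_comp)
  moreover have "(hglob_id F a \<ast>\<^sub>h sq_hor L (on_hor F f)) \<ast>\<^sub>v hglob_comp F f (hor_id K a)
      = sq_hor L (on_hor F f)"
    using hor_coherence_id_right assms by blast
  moreover have "((vinv L (hglob_id F a) \<ast>\<^sub>h sq_hor L (on_hor F f))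
        \<ast>\<^sub>v (hglob_id F a \<ast>\<^sub>h sq_hor L (on_hor F f))) \<ast>\<^sub>v hglob_comp F f (hor_id K a)
      = (vinv L (hglob_id F a) \<ast>\<^sub>h sq_hor L (on_hor F f))
        \<ast>\<^sub>v ((hglob_id F a \<ast>\<^sub>h sq_hor L (on_hor F f)) \<ast>\<^sub>v hglob_comp F f (hor_id K a))"
    using assms a by (intro target.vcomp_assoc) simp_all
  ultimately show ?thesis
    using assms a by simp
qed

lemma hglob_comp_id_left:
  assumes "f \<in> Hor K" "hor_cod K f = b"
  shows "hglob_comp F (hor_id K b) f = sq_hor L (on_hor F f) \<ast>\<^sub>h vinv L (hglob_id F b)"
proof -
  have b: "b \<in> Obj K" using assms by auto
  have "(sq_hor L (on_hor F f) \<ast>\<^sub>h vinv L (hglob_id F b)) \<ast>\<^sub>v (sq_hor L (on_hor F f) \<ast>\<^sub>h hglob_id F b)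
      = sq_hor L (on_hor F (hor_id K b) \<circ>\<^sub>h on_hor F f)"
    using assms b by (simp add: target.interchange target.sq_hor_comp)
  moreover have "(sq_hor L (on_hor F f) \<ast>\<^sub>h hglob_id F b) \<ast>\<^sub>v hglob_comp F (hor_id K b) f
      = sq_hor L (on_hor F f)"
    using hor_coherence_id_left assms by blast
  moreover have "((sq_hor L (on_hor F f) \<ast>\<^sub>h vinv L (hglob_id F b))
        \<ast>\<^sub>v (sq_hor L (on_hor F f) \<ast>\<^sub>h hglob_id F b)) \<ast>\<^sub>v hglob_comp F (hor_id K b) f
      = (sq_hor L (on_hor F f) \<ast>\<^sub>h vinv L (hglob_id F b))
        \<ast>\<^sub>v ((sq_hor L (on_hor F f) \<ast>\<^sub>h hglob_id F b) \<ast>\<^sub>v hglob_comp F (hor_id K b) f)"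
    using assms b by (intro target.vcomp_assoc) simp_all
  ultimately show ?thesis
    using assms b by simp
qed

text \<open>The vertical unit laws are solved in the same way, now cancelling an invertible square
  with respect to \<ast>\<open>\<^sub>h\<close>.\<close>

lemma vglob_comp_id_right:
  assumes "u \<in> Ver K" "ver_dom K u = a"
  shows "vglob_comp F u (ver_id K a) = sq_ver L (on_ver F u) \<ast>\<^sub>v hinv L (vglob_id F a)"
proof -
  have a: "a \<in> Obj K" using assms by auto
  have "(sq_ver L (on_ver F u) \<ast>\<^sub>v hinv L (vglob_id F a)) \<ast>\<^sub>h (sq_ver L (on_ver F u) \<ast>\<^sub>v vglob_id F a)
      = sq_ver L (on_ver F u \<circ>\<^sub>v on_ver F (ver_id K a))"
    using assms a by (simp add: target.interchange [symmetric] target.sq_ver_comp)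
  moreover have "(sq_ver L (on_ver F u) \<ast>\<^sub>v vglob_id F a) \<ast>\<^sub>h vglob_comp F u (ver_id K a)
      = sq_ver L (on_ver F u)"
    using ver_coherence_id_right assms by blast
  moreover have "((sq_ver L (on_ver F u) \<ast>\<^sub>v hinv L (vglob_id F a))
        \<ast>\<^sub>h (sq_ver L (on_ver F u) \<ast>\<^sub>v vglob_id F a)) \<ast>\<^sub>h vglob_comp F u (ver_id K a)
      = (sq_ver L (on_ver F u) \<ast>\<^sub>v hinv L (vglob_id F a))
        \<ast>\<^sub>h ((sq_ver L (on_ver F u) \<ast>\<^sub>v vglob_id F a) \<ast>\<^sub>h vglob_comp F u (ver_id K a))"
    using assms a by (intro target.hcomp_assoc) simp_all
  ultimately show ?thesis
    using assms a by simp
qed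

lemma vglob_comp_id_left:
  assumes "u \<in> Ver K" "ver_cod K u = b"
  shows "vglob_comp F (ver_id K b) u = hinv L (vglob_id F b) \<ast>\<^sub>v sq_ver L (on_ver F u)"
proof -
  have b: "b \<in> Obj K" using assms by auto
  have "(hinv L (vglob_id F b) \<ast>\<^sub>v sq_ver L (on_ver F u)) \<ast>\<^sub>h (vglob_id F b \<ast>\<^sub>v sq_ver L (on_ver F u))
      = sq_ver L (on_ver F (ver_id K b) \<circ>\<^sub>v on_ver F u)"
    using assms b by (simp add: target.interchange [symmetric] target.sq_ver_comp)
  moreover have "(vglob_id F b \<ast>\<^sub>v sq_ver L (on_ver F u)) \<ast>\<^sub>h vglob_comp F (ver_id K b) u
      = sq_ver L (on_ver F u)"
    using ver_coherence_id_left assms by blast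
  moreover have "((hinv L (vglob_id F b) \<ast>\<^sub>v sq_ver L (on_ver F u))
        \<ast>\<^sub>h (vglob_id F b \<ast>\<^sub>v sq_ver L (on_ver F u))) \<ast>\<^sub>h vglob_comp F (ver_id K b) u
      = (hinv L (vglob_id F b) \<ast>\<^sub>v sq_ver L (on_ver F u))
        \<ast>\<^sub>h ((vglob_id F b \<ast>\<^sub>v sq_ver L (on_ver F u)) \<ast>\<^sub>h vglob_comp F (ver_id K b) u)"
    using assms b by (intro target.hcomp_assoc) simp_all
  ultimately show ?thesis
    using assms b by simp
qed

end

section \<open>Companions\<close>

context double_category
begin

lemma companion_pair_simps [simp]:
  assumes "companion_pair K C"
  shows "cpn_ver C \<in> Ver K" "cpn_hor C \<in> Hor K"
    "hor_dom K (cpn_hor C) = ver_dom K (cpn_ver C)"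
    "hor_cod K (cpn_hor C) = ver_cod K (cpn_ver C)"
    "cpn_phi C \<in> Sqr K" "top_edge K (cpn_phi C) = cpn_hor C" "left_edge K (cpn_phi C) = cpn_ver C"
    "right_edge K (cpn_phi C) = ver_id K (ver_cod K (cpn_ver C))"
    "bottom_edge K (cpn_phi C) = hor_id K (ver_cod K (cpn_ver C))"
    "cpn_psi C \<in> Sqr K" "top_edge K (cpn_psi C) = hor_id K (ver_dom K (cpn_ver C))"
    "left_edge K (cpn_psi C) = ver_id K (ver_dom K (cpn_ver C))"
    "right_edge K (cpn_psi C) = cpn_ver C" "bottom_edge K (cpn_psi C) = cpn_hor C"
    "cpn_phi C \<ast>\<^sub>v cpn_psi C = sq_ver K (cpn_ver C)"
    "cpn_psi C \<ast>\<^sub>h cpn_phi C = sq_hor K (cpn_hor C)"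
  using assms by (simp_all add: companion_pair_def square_def Let_def)

end

section \<open>Induced companion pairs and preservation of their mates\<close>

context double_pseudofunctor
begin

text \<open>These are two forms of naturality at the identity square on \<open>u\<close>, with one
  of the two unit comparisons moved to the other side. They let a unit comparison slide past the
  image of that square.\<close>

lemma on_sqr_sq_ver:
  assumes "u \<in> Ver K" "ver_dom K u = a" "ver_cod K u = b"
  shows "on_sqr F (sq_ver K u) \<ast>\<^sub>v vinv L (hglob_id F a)
      = vinv L (hglob_id F b) \<ast>\<^sub>v sq_ver L (on_ver F u)"
    and "hglob_id F b \<ast>\<^sub>v on_sqr F (sq_ver K u) = sq_ver L (on_ver F u) \<ast>\<^sub>v hglob_id F a"
proof -
  have ob: "a \<in> Obj K" "b \<in> Obj K" using assms by auto
  have N: "hglob_id F b \<ast>\<^sub>v (on_sqr F (sq_ver K u) \<ast>\<^sub>v vinv L (hglob_id F a)) = sq_ver L (on_ver F u)"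
    using naturality_sq_ver [of u] assms ob by (simp add: target.vcomp_assoc)
  have "vinv L (hglob_id F b) \<ast>\<^sub>v sq_ver L (on_ver F u)
      = (vinv L (hglob_id F b) \<ast>\<^sub>v hglob_id F b) \<ast>\<^sub>v (on_sqr F (sq_ver K u) \<ast>\<^sub>v vinv L (hglob_id F a))"
    using assms ob unfolding N [symmetric] by (intro target.vcomp_assoc [symmetric]) simp_all
  then show "on_sqr F (sq_ver K u) \<ast>\<^sub>v vinv L (hglob_id F a)
      = vinv L (hglob_id F b) \<ast>\<^sub>v sq_ver L (on_ver F u)"
    using assms ob by simp
  \<comment> \<open>Here the simplifier only rebrackets, since the cancellation laws are withheld;
    the pair of mutually inverse squares on the right disappears in the next step.\<close>
  have "sq_ver L (on_ver F u) \<ast>\<^sub>v hglob_id F a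
      = (hglob_id F b \<ast>\<^sub>v on_sqr F (sq_ver K u)) \<ast>\<^sub>v (vinv L (hglob_id F a) \<ast>\<^sub>v hglob_id F a)"
    using assms ob unfolding N [symmetric]
    by (simp add: target.vcomp_assoc del: vinv_hglob_id(6,7) target.units)
  then show "hglob_id F b \<ast>\<^sub>v on_sqr F (sq_ver K u) = sq_ver L (on_ver F u) \<ast>\<^sub>v hglob_id F a"
    using assms ob by simp
qed

text \<open>This is the image of \<phi> \<ast>\<open>\<^sub>v\<close> \<psi> = \<open>1^f\<close>.
  Naturality relates the two sides through the comparison squares for \<open>1_b f\<close> and
  \<open>f 1_a\<close>, and unit coherence expresses those by the inverses of \<open>F^b\<close> and
  \<open>F^a\<close>.\<close>

lemma companion_vcomp:
  assumes "companion_pair K C"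
    and f: "f = cpn_ver C" "a = ver_dom K f" "b = ver_cod K f"
  shows "(on_sqr F (cpn_phi C) \<ast>\<^sub>h hinv L (vglob_id F b)) \<ast>\<^sub>v (vglob_id F a \<ast>\<^sub>h on_sqr F (cpn_psi C))
    = on_sqr F (sq_ver K f)"
proof -
  note [simp] = assms
  have N: "(on_sqr F (cpn_phi C) \<ast>\<^sub>v on_sqr F (cpn_psi C)) \<ast>\<^sub>h (hinv L (vglob_id F b) \<ast>\<^sub>v sq_ver L (on_ver F f))
      = (sq_ver L (on_ver F f) \<ast>\<^sub>v hinv L (vglob_id F a)) \<ast>\<^sub>h on_sqr F (sq_ver K f)"
    using naturality_vcomp [of "cpn_psi C" "cpn_phi C"]
    by (simp add: vglob_comp_id_left vglob_comp_id_right)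
  \<comment> \<open>Identity squares pad both rows to three squares with matching columns, so that
    interchange applies. The unit laws are switched off in the next step to keep the
    padding.\<close>
  have "(on_sqr F (cpn_phi C) \<ast>\<^sub>h hinv L (vglob_id F b)) \<ast>\<^sub>v (vglob_id F a \<ast>\<^sub>h on_sqr F (cpn_psi C))
      = (sq_ver L (on_ver F f) \<ast>\<^sub>h (on_sqr F (cpn_phi C) \<ast>\<^sub>h hinv L (vglob_id F b)))
        \<ast>\<^sub>v (vglob_id F a \<ast>\<^sub>h (on_sqr F (cpn_psi C) \<ast>\<^sub>h sq_ver L (on_ver F f)))"
    by simp
  also have "\<dots> = (sq_ver L (on_ver F f) \<ast>\<^sub>v vglob_id F a) \<ast>\<^sub>h
      ((on_sqr F (cpn_phi C) \<ast>\<^sub>v on_sqr F (cpn_psi C)) \<ast>\<^sub>h (hinv L (vglob_id F b) \<ast>\<^sub>v sq_ver L (on_ver F f)))"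
    by (simp add: target.interchange del: target.units(5-) target.hcomp_sq_hor_id)
  \<comment> \<open>By \<open>N\<close> the last two columns begin with the whiskered inverse of
    \<open>F^a\<close>, which cancels the first column.\<close>
  also have "\<dots> = ((sq_ver L (on_ver F f) \<ast>\<^sub>v vglob_id F a) \<ast>\<^sub>h
      (sq_ver L (on_ver F f) \<ast>\<^sub>v hinv L (vglob_id F a))) \<ast>\<^sub>h on_sqr F (sq_ver K f)"
    unfolding N by (intro target.hcomp_assoc [symmetric]) simp_all
  also have "\<dots> = on_sqr F (sq_ver K f)"
    by (simp add: target.interchange [symmetric])
  finally show ?thesis .
qed

text \<open>The argument of \<open>companion_vcomp\<close> with the two directions exchanged,
  starting from \<psi> \<ast>\<open>\<^sub>h\<close> \<phi> = \<open>1_{f'}\<close>.\<close>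

lemma companion_hcomp:
  assumes "companion_pair K C"
    and f: "f = cpn_ver C" "f' = cpn_hor C" "a = ver_dom K f" "b = ver_cod K f"
  shows "(on_sqr F (cpn_psi C) \<ast>\<^sub>v vinv L (hglob_id F a)) \<ast>\<^sub>h (hglob_id F b \<ast>\<^sub>v on_sqr F (cpn_phi C))
    = on_sqr F (sq_hor K f')"
proof -
  note [simp] = assms
  have N: "(on_sqr F (cpn_psi C) \<ast>\<^sub>h on_sqr F (cpn_phi C)) \<ast>\<^sub>v (vinv L (hglob_id F a) \<ast>\<^sub>h sq_hor L (on_hor F f'))
      = (sq_hor L (on_hor F f') \<ast>\<^sub>h vinv L (hglob_id F b)) \<ast>\<^sub>v on_sqr F (sq_hor K f')"
    using naturality_hcomp [of "cpn_psi C" "cpn_phi C"]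
    by (simp add: hglob_comp_id_left hglob_comp_id_right)
  have "(on_sqr F (cpn_psi C) \<ast>\<^sub>v vinv L (hglob_id F a)) \<ast>\<^sub>h (hglob_id F b \<ast>\<^sub>v on_sqr F (cpn_phi C))
      = (sq_hor L (on_hor F f') \<ast>\<^sub>v (on_sqr F (cpn_psi C) \<ast>\<^sub>v vinv L (hglob_id F a)))
        \<ast>\<^sub>h (hglob_id F b \<ast>\<^sub>v (on_sqr F (cpn_phi C) \<ast>\<^sub>v sq_hor L (on_hor F f')))"
    by simp
  also have "\<dots> = (sq_hor L (on_hor F f') \<ast>\<^sub>h hglob_id F b) \<ast>\<^sub>v
      ((on_sqr F (cpn_psi C) \<ast>\<^sub>h on_sqr F (cpn_phi C)) \<ast>\<^sub>v (vinv L (hglob_id F a) \<ast>\<^sub>h sq_hor L (on_hor F f')))"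
    by (simp add: target.interchange del: target.units(5-) target.hcomp_sq_hor_id)
  also have "\<dots> = ((sq_hor L (on_hor F f') \<ast>\<^sub>h hglob_id F b) \<ast>\<^sub>v
      (sq_hor L (on_hor F f') \<ast>\<^sub>h vinv L (hglob_id F b))) \<ast>\<^sub>v on_sqr F (sq_hor K f')"
    unfolding N by (intro target.vcomp_assoc [symmetric]) simp_all
  also have "\<dots> = on_sqr F (sq_hor K f')"
    by (simp add: target.interchange target.sq_hor_comp [symmetric])
  finally show ?thesis .
qed

text \<open>The inner squares of the two composites form the images of identity squares, by
  \<open>companion_vcomp\<close> and \<open>companion_hcomp\<close>. The remaining unit comparisons
  turn these images into identity squares by naturality at \<open>1^f\<close> and at
  \<open>1_{f'}\<close>.\<close>

lemma companion_pair_induced: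
  assumes "companion_pair K C"
  shows "companion_pair L (induced_companion K L F C)"
proof -
  note [simp] = assms
  define f where "f = cpn_ver C"
  define f' where "f' = cpn_hor C"
  define a where "a = ver_dom K f"
  define b where "b = ver_cod K f"
  note d = f_def f'_def a_def b_def
  define \<Phi> where "\<Phi> = on_sqr F (cpn_phi C)"
  define \<Psi> where "\<Psi> = on_sqr F (cpn_psi C)"
  have [simp]: "a \<in> Obj K" "b \<in> Obj K" "f \<in> Ver K" "f' \<in> Hor K"
    "ver_dom K f = a" "ver_cod K f = b" "hor_dom K f' = a" "hor_cod K f' = b"
    "\<Phi> \<in> Sqr L" "\<Psi> \<in> Sqr L"
    "top_edge L \<Phi> = on_hor F f'" "left_edge L \<Phi> = on_ver F f"
    "right_edge L \<Phi> = on_ver F (ver_id K b)" "bottom_edge L \<Phi> = on_hor F (hor_id K b)"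
    "top_edge L \<Psi> = on_hor F (hor_id K a)" "left_edge L \<Psi> = on_ver F (ver_id K a)"
    "right_edge L \<Psi> = on_ver F f" "bottom_edge L \<Psi> = on_hor F f'"
    by (simp_all add: d \<Phi>_def \<Psi>_def)
  have V: "(\<Phi> \<ast>\<^sub>h hinv L (vglob_id F b)) \<ast>\<^sub>v (vglob_id F a \<ast>\<^sub>h \<Psi>) = on_sqr F (sq_ver K f)"
    and H: "(\<Psi> \<ast>\<^sub>v vinv L (hglob_id F a)) \<ast>\<^sub>h (hglob_id F b \<ast>\<^sub>v \<Phi>) = on_sqr F (sq_hor K f')"
    unfolding \<Phi>_def \<Psi>_def by (rule companion_vcomp companion_hcomp, simp_all only: assms d)+
  have "(hglob_id F b \<ast>\<^sub>v (\<Phi> \<ast>\<^sub>h hinv L (vglob_id F b))) \<ast>\<^sub>v ((vglob_id F a \<ast>\<^sub>h \<Psi>) \<ast>\<^sub>v vinv L (hglob_id F a))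
      = hglob_id F b \<ast>\<^sub>v ((\<Phi> \<ast>\<^sub>h hinv L (vglob_id F b)) \<ast>\<^sub>v (vglob_id F a \<ast>\<^sub>h \<Psi>)) \<ast>\<^sub>v vinv L (hglob_id F a)"
    by (simp add: target.vcomp_assoc)
  also have "\<dots> = sq_ver L (on_ver F f)"
    unfolding V using naturality_sq_ver [of f] by simp
  finally have 1: "(hglob_id F b \<ast>\<^sub>v (\<Phi> \<ast>\<^sub>h hinv L (vglob_id F b)))
      \<ast>\<^sub>v ((vglob_id F a \<ast>\<^sub>h \<Psi>) \<ast>\<^sub>v vinv L (hglob_id F a)) = sq_ver L (on_ver F f)" .
  \<comment> \<open>The two unit comparisons can be attached in either order. The given form suits
    the vertical composite, the new one the horizontal composite, where the vertically globular
    squares must be outermost.\<close>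
  have \<Phi>': "hglob_id F b \<ast>\<^sub>v (\<Phi> \<ast>\<^sub>h hinv L (vglob_id F b)) = (hglob_id F b \<ast>\<^sub>v \<Phi>) \<ast>\<^sub>h hinv L (vglob_id F b)"
    using target.interchange [of \<Phi> "hinv L (vglob_id F b)" "hglob_id F b" "sq_hor L (hor_id L (on_obj F b))"]
    by simp
  have \<Psi>': "(vglob_id F a \<ast>\<^sub>h \<Psi>) \<ast>\<^sub>v vinv L (hglob_id F a) = vglob_id F a \<ast>\<^sub>h (\<Psi> \<ast>\<^sub>v vinv L (hglob_id F a))"
    using target.interchange [of "sq_hor L (hor_id L (on_obj F a))" "vinv L (hglob_id F a)" "vglob_id F a" \<Psi>]
    by simp
  have "((vglob_id F a \<ast>\<^sub>h \<Psi>) \<ast>\<^sub>v vinv L (hglob_id F a)) \<ast>\<^sub>h (hglob_id F b \<ast>\<^sub>v (\<Phi> \<ast>\<^sub>h hinv L (vglob_id F b)))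
      = vglob_id F a \<ast>\<^sub>h ((\<Psi> \<ast>\<^sub>v vinv L (hglob_id F a)) \<ast>\<^sub>h (hglob_id F b \<ast>\<^sub>v \<Phi>)) \<ast>\<^sub>h hinv L (vglob_id F b)"
    unfolding \<Phi>' \<Psi>' by (simp add: target.hcomp_assoc)
  also have "\<dots> = sq_hor L (on_hor F f')"
    unfolding H using naturality_sq_hor [of f'] by simp
  finally have 2: "((vglob_id F a \<ast>\<^sub>h \<Psi>) \<ast>\<^sub>v vinv L (hglob_id F a))
      \<ast>\<^sub>h (hglob_id F b \<ast>\<^sub>v (\<Phi> \<ast>\<^sub>h hinv L (vglob_id F b))) = sq_hor L (on_hor F f')" .
  show ?thesis
    unfolding companion_pair_def induced_companion_def Let_def square_def companion.simps
    unfolding f_def [symmetric] f'_def [symmetric] \<Phi>_def [symmetric] \<Psi>_def [symmetric]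
      a_def [symmetric] b_def [symmetric]
    by (simp add: 1 2)
qed

text \<open>The left edge of \<psi> is an identity, so in vertical naturality the left comparison
  square is a whiskered inverse of \<open>F^a\<close> and only \<open>F^{fi}\<close> survives, on
  the right. Sliding \<open>F_x^{-1}\<close> through the image of \<open>1^i\<close> turns it into
  the \<open>F_a^{-1}\<close> that the induced \<psi> contains.\<close>

lemma on_sqr_psi_whisker:
  assumes "companion_pair K C" "i \<in> Ver K"
    and d: "f = cpn_ver C" "x = ver_dom K i" "ver_cod K i = ver_dom K f"
  shows "on_sqr F (cpn_psi C \<ast>\<^sub>v\<^bsub>K\<^esub> sq_ver K i) \<ast>\<^sub>v vinv L (hglob_id F x)
    = (cpn_psi (induced_companion K L F C) \<ast>\<^sub>v sq_ver L (on_ver F i)) \<ast>\<^sub>h vglob_comp F f i"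
proof -
  note [simp] = assms
  let ?a = "ver_dom K f"
  let ?\<psi> = "on_sqr F (cpn_psi C)"
  have N: "(hinv L (vglob_id F ?a) \<ast>\<^sub>v sq_ver L (on_ver F i)) \<ast>\<^sub>h on_sqr F (cpn_psi C \<ast>\<^sub>v\<^bsub>K\<^esub> sq_ver K i)
      = (?\<psi> \<ast>\<^sub>v on_sqr F (sq_ver K i)) \<ast>\<^sub>h vglob_comp F f i"
    using naturality_vcomp [of "sq_ver K i" "cpn_psi C"] by (simp add: vglob_comp_id_left)
  have "on_sqr F (cpn_psi C \<ast>\<^sub>v\<^bsub>K\<^esub> sq_ver K i)
      = ((vglob_id F ?a \<ast>\<^sub>v sq_ver L (on_ver F i)) \<ast>\<^sub>h (hinv L (vglob_id F ?a) \<ast>\<^sub>v sq_ver L (on_ver F i)))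
        \<ast>\<^sub>h on_sqr F (cpn_psi C \<ast>\<^sub>v\<^bsub>K\<^esub> sq_ver K i)"
    by (simp add: target.interchange [symmetric])
  also have "\<dots> = (vglob_id F ?a \<ast>\<^sub>v sq_ver L (on_ver F i))
        \<ast>\<^sub>h ((?\<psi> \<ast>\<^sub>v on_sqr F (sq_ver K i)) \<ast>\<^sub>h vglob_comp F f i)"
    unfolding N [symmetric] by (intro target.hcomp_assoc) simp_all
  also have "\<dots> = ((vglob_id F ?a \<ast>\<^sub>v sq_ver L (on_ver F i)) \<ast>\<^sub>h (?\<psi> \<ast>\<^sub>v on_sqr F (sq_ver K i)))
        \<ast>\<^sub>h vglob_comp F f i"
    by (intro target.hcomp_assoc [symmetric]) simp_all
  also have "\<dots> = ((vglob_id F ?a \<ast>\<^sub>h ?\<psi>) \<ast>\<^sub>v on_sqr F (sq_ver K i)) \<ast>\<^sub>h vglob_comp F f i"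
    by (simp add: target.interchange [symmetric])
  \<comment> \<open>The top of \<open>F^{fi}\<close> is the identity \<open>1^{Fx}\<close>. Putting
    an identity square above it lets interchange confine \<open>F_x^{-1}\<close> to the first
    column.\<close>
  finally have "on_sqr F (cpn_psi C \<ast>\<^sub>v\<^bsub>K\<^esub> sq_ver K i) \<ast>\<^sub>v vinv L (hglob_id F x)
      = (((vglob_id F ?a \<ast>\<^sub>h ?\<psi>) \<ast>\<^sub>v on_sqr F (sq_ver K i)) \<ast>\<^sub>h vglob_comp F f i)
        \<ast>\<^sub>v (vinv L (hglob_id F x) \<ast>\<^sub>h sq_hor L (hor_id L (on_obj F x)))"
    by simp
  also have "\<dots> = (((vglob_id F ?a \<ast>\<^sub>h ?\<psi>) \<ast>\<^sub>v on_sqr F (sq_ver K i)) \<ast>\<^sub>v vinv L (hglob_id F x))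
        \<ast>\<^sub>h vglob_comp F f i"
    by (simp add: target.interchange del: target.hcomp_sq_hor_id)
  also have "((vglob_id F ?a \<ast>\<^sub>h ?\<psi>) \<ast>\<^sub>v on_sqr F (sq_ver K i)) \<ast>\<^sub>v vinv L (hglob_id F x)
      = (vglob_id F ?a \<ast>\<^sub>h ?\<psi>) \<ast>\<^sub>v (on_sqr F (sq_ver K i) \<ast>\<^sub>v vinv L (hglob_id F x))"
    by (simp add: target.vcomp_assoc)
  also have "\<dots> = ((vglob_id F ?a \<ast>\<^sub>h ?\<psi>) \<ast>\<^sub>v vinv L (hglob_id F ?a)) \<ast>\<^sub>v sq_ver L (on_ver F i)"
    by (simp add: target.vcomp_assoc on_sqr_sq_ver)
  finally show ?thesis
    by (simp add: induced_companion_def Let_def)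
qed

text \<open>Now the right edge of \<phi> is an identity, so \<open>F^{mf}\<close> survives on the
  left and crosses the equation as its inverse. \<open>F_y\<close> slides up through the image of
  \<open>1^m\<close> and becomes the \<open>F_b\<close> of the induced \<phi>.\<close>

lemma on_sqr_phi_whisker:
  assumes "companion_pair K C" "m \<in> Ver K"
    and d: "f = cpn_ver C" "y = ver_cod K m" "ver_dom K m = ver_cod K f"
  shows "hglob_id F y \<ast>\<^sub>v on_sqr F (sq_ver K m \<ast>\<^sub>v\<^bsub>K\<^esub> cpn_phi C)
    = hinv L (vglob_comp F m f) \<ast>\<^sub>h (sq_ver L (on_ver F m) \<ast>\<^sub>v cpn_phi (induced_companion K L F C))"
proof -
  note [simp] = assms
  let ?b = "ver_cod K f"
  let ?\<phi> = "on_sqr F (cpn_phi C)"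
  have N: "vglob_comp F m f \<ast>\<^sub>h on_sqr F (sq_ver K m \<ast>\<^sub>v\<^bsub>K\<^esub> cpn_phi C)
      = (on_sqr F (sq_ver K m) \<ast>\<^sub>v ?\<phi>) \<ast>\<^sub>h (sq_ver L (on_ver F m) \<ast>\<^sub>v hinv L (vglob_id F ?b))"
    using naturality_vcomp [of "cpn_phi C" "sq_ver K m"] by (simp add: vglob_comp_id_right)
  have "on_sqr F (sq_ver K m \<ast>\<^sub>v\<^bsub>K\<^esub> cpn_phi C)
      = (hinv L (vglob_comp F m f) \<ast>\<^sub>h vglob_comp F m f) \<ast>\<^sub>h on_sqr F (sq_ver K m \<ast>\<^sub>v\<^bsub>K\<^esub> cpn_phi C)"
    by simp
  also have "\<dots> = hinv L (vglob_comp F m f)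
        \<ast>\<^sub>h ((on_sqr F (sq_ver K m) \<ast>\<^sub>v ?\<phi>) \<ast>\<^sub>h (sq_ver L (on_ver F m) \<ast>\<^sub>v hinv L (vglob_id F ?b)))"
    unfolding N [symmetric] by (intro target.hcomp_assoc) simp_all
  also have "\<dots> = hinv L (vglob_comp F m f)
        \<ast>\<^sub>h (on_sqr F (sq_ver K m) \<ast>\<^sub>v (?\<phi> \<ast>\<^sub>h hinv L (vglob_id F ?b)))"
    by (simp add: target.interchange [symmetric])
  finally have "hglob_id F y \<ast>\<^sub>v on_sqr F (sq_ver K m \<ast>\<^sub>v\<^bsub>K\<^esub> cpn_phi C)
      = (sq_hor L (hor_id L (on_obj F y)) \<ast>\<^sub>h hglob_id F y) \<ast>\<^sub>v (hinv L (vglob_comp F m f)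
        \<ast>\<^sub>h (on_sqr F (sq_ver K m) \<ast>\<^sub>v (?\<phi> \<ast>\<^sub>h hinv L (vglob_id F ?b))))"
    by simp
  also have "\<dots> = hinv L (vglob_comp F m f)
        \<ast>\<^sub>h ((hglob_id F y \<ast>\<^sub>v on_sqr F (sq_ver K m)) \<ast>\<^sub>v (?\<phi> \<ast>\<^sub>h hinv L (vglob_id F ?b)))"
    by (simp add: target.interchange target.vcomp_assoc del: target.hcomp_sq_hor_id)
  also have "hglob_id F y \<ast>\<^sub>v on_sqr F (sq_ver K m) = sq_ver L (on_ver F m) \<ast>\<^sub>v hglob_id F ?b"
    by (simp add: on_sqr_sq_ver)
  finally show ?thesis
    by (simp add: induced_companion_def Let_def target.vcomp_assoc)
qed

text \<open>The top comparison in horizontal naturality is taken at an identity 1-cell, hence is a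
  whiskered \<open>F_x^{-1}\<close>, and interchange absorbs it into the column of
  \<open>X\<close>.\<close>

lemma on_sqr_hcomp_unit_top:
  assumes "\<alpha> \<in> Sqr K" "X \<in> Sqr K" "right_edge K X = left_edge K \<alpha>" "top_edge K X = hor_id K x" "x \<in> Obj K"
  shows "hglob_comp F (bottom_edge K \<alpha>) (bottom_edge K X) \<ast>\<^sub>v on_sqr F (X \<ast>\<^sub>h\<^bsub>K\<^esub> \<alpha>)
    = (on_sqr F X \<ast>\<^sub>v vinv L (hglob_id F x)) \<ast>\<^sub>h on_sqr F \<alpha>"
proof -
  have "hor_dom K (top_edge K \<alpha>) = x"
    using assms source.corner_top_left [of \<alpha>] source.corner_top_right [of X] by simp
  then show ?thesis
    using naturality_hcomp [of X \<alpha>] assms by (simp add: hglob_comp_id_right target.interchange)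
qed

text \<open>Here the bottom comparison is a whiskered \<open>F_y^{-1}\<close>. It moves to the other
  side as \<open>F_y\<close> and joins the column of \<open>Y\<close>, while the top comparison is
  cancelled by its inverse.\<close>

lemma on_sqr_hcomp_unit_bottom:
  assumes "\<alpha> \<in> Sqr K" "Y \<in> Sqr K" "right_edge K \<alpha> = left_edge K Y" "bottom_edge K Y = hor_id K y" "y \<in> Obj K"
  shows "on_sqr F (\<alpha> \<ast>\<^sub>h\<^bsub>K\<^esub> Y) \<ast>\<^sub>v vinv L (hglob_comp F (top_edge K Y) (top_edge K \<alpha>))
    = on_sqr F \<alpha> \<ast>\<^sub>h (hglob_id F y \<ast>\<^sub>v on_sqr F Y)"
proof -
  have y [simp]: "ver_cod K (left_edge K Y) = y"
    using assms by (metis source.corner_bottom_left source.hor.dm_idn)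
  have [simp]: "hor_cod K (bottom_edge K \<alpha>) = y" "hor_cod K (top_edge K \<alpha>) = hor_dom K (top_edge K Y)"
    using assms y by (simp_all add: source.corner_bottom_right source.corner_top_right source.corner_top_left)
  note [simp] = assms
  let ?n = "bottom_edge K \<alpha>" let ?t = "hglob_comp F (top_edge K Y) (top_edge K \<alpha>)"
  have N: "(on_sqr F \<alpha> \<ast>\<^sub>h on_sqr F Y) \<ast>\<^sub>v ?t
      = (sq_hor L (on_hor F ?n) \<ast>\<^sub>h vinv L (hglob_id F y)) \<ast>\<^sub>v on_sqr F (\<alpha> \<ast>\<^sub>h\<^bsub>K\<^esub> Y)"
    using naturality_hcomp [of \<alpha> Y] by (simp add: hglob_comp_id_left)
  have "on_sqr F (\<alpha> \<ast>\<^sub>h\<^bsub>K\<^esub> Y) = ((sq_hor L (on_hor F ?n) \<ast>\<^sub>h hglob_id F y)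
      \<ast>\<^sub>v (sq_hor L (on_hor F ?n) \<ast>\<^sub>h vinv L (hglob_id F y))) \<ast>\<^sub>v on_sqr F (\<alpha> \<ast>\<^sub>h\<^bsub>K\<^esub> Y)"
    by (simp add: target.interchange target.sq_hor_comp [symmetric])
  also have "\<dots> = (sq_hor L (on_hor F ?n) \<ast>\<^sub>h hglob_id F y) \<ast>\<^sub>v ((on_sqr F \<alpha> \<ast>\<^sub>h on_sqr F Y) \<ast>\<^sub>v ?t)"
    unfolding N by (intro target.vcomp_assoc) simp_all
  finally have "on_sqr F (\<alpha> \<ast>\<^sub>h\<^bsub>K\<^esub> Y) \<ast>\<^sub>v vinv L ?t
      = ((sq_hor L (on_hor F ?n) \<ast>\<^sub>h hglob_id F y) \<ast>\<^sub>v (on_sqr F \<alpha> \<ast>\<^sub>h on_sqr F Y)) \<ast>\<^sub>v (?t \<ast>\<^sub>v vinv L ?t)"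
    by (simp add: target.vcomp_assoc del: vinv_hglob_comp(6) target.units)
  then show ?thesis
    by (simp add: target.interchange)
qed

lemma companion_mates_preserved:
  assumes "companion_mates K C D i j m n \<alpha> \<beta>"
  shows "companion_mates L (induced_companion K L F C) (induced_companion K L F D)
      (on_ver F i) (on_hor F j) (on_ver F m) (on_hor F n)
      (vglob_comp F (cpn_ver C) i \<ast>\<^sub>h on_sqr F \<alpha> \<ast>\<^sub>h hinv L (vglob_comp F m (cpn_ver D)))
      (hglob_comp F n (cpn_hor C) \<ast>\<^sub>v on_sqr F \<beta> \<ast>\<^sub>v vinv L (hglob_comp F (cpn_hor D) j))"
proof -
  define f where "f = cpn_ver C"
  define f' where "f' = cpn_hor C"
  define g where "g = cpn_ver D"
  define g' where "g' = cpn_hor D"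
  define X where "X = cpn_psi C \<ast>\<^sub>v\<^bsub>K\<^esub> sq_ver K i"
  define Y where "Y = sq_ver K m \<ast>\<^sub>v\<^bsub>K\<^esub> cpn_phi D"
  define x where "x = ver_dom K i"
  define y where "y = ver_cod K m"
  define \<Psi> where "\<Psi> = cpn_psi (induced_companion K L F C)"
  define \<Phi> where "\<Phi> = cpn_phi (induced_companion K L F D)"
  note d = f_def f'_def g_def g'_def x_def y_def
  have C [simp]: "companion_pair K C" "companion_pair K D"
    and ind [simp]: "companion_pair L (induced_companion K L F C)" "companion_pair L (induced_companion K L F D)"
    using assms companion_pair_induced by (auto simp: companion_mates_def Let_def)
  have [simp]: "i \<in> Ver K" "m \<in> Ver K" "ver_cod K i = ver_dom K f" "ver_dom K m = ver_cod K g"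
    "\<alpha> \<in> Sqr K" "top_edge K \<alpha> = j" "left_edge K \<alpha> = f \<circ>\<^sub>v\<^bsub>K\<^esub> i" "right_edge K \<alpha> = m \<circ>\<^sub>v\<^bsub>K\<^esub> g"
    "bottom_edge K \<alpha> = n" "\<beta> \<in> Sqr K" "top_edge K \<beta> = g' \<circ>\<^sub>h\<^bsub>K\<^esub> j" "left_edge K \<beta> = i"
    "right_edge K \<beta> = m" "bottom_edge K \<beta> = n \<circ>\<^sub>h\<^bsub>K\<^esub> f'" and \<beta>: "\<beta> = X \<ast>\<^sub>h\<^bsub>K\<^esub> \<alpha> \<ast>\<^sub>h\<^bsub>K\<^esub> Y"
    using assms unfolding companion_mates_def square_def Let_def d X_def Y_def by blast+
  have [simp]: "f \<in> Ver K" "g \<in> Ver K" "f' \<in> Hor K" "g' \<in> Hor K" "x \<in> Obj K" "y \<in> Obj K"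
    "hor_dom K f' = ver_dom K f" "hor_cod K f' = ver_cod K f" "hor_dom K g' = ver_dom K g" "hor_cod K g' = ver_cod K g"
    "ver_dom K i = x" "ver_cod K m = y"
    by (simp_all add: d)
  have [simp]: "j \<in> Hor K" "n \<in> Hor K"
    using source.vsq.dm_closed [of \<alpha>] source.vsq.cd_closed [of \<alpha>] by simp_all
  have [simp]: "hor_dom K j = x" "hor_cod K j = ver_dom K g" "hor_dom K n = ver_cod K f" "hor_cod K n = y"
    using source.corner_top_left [of \<alpha>] source.corner_top_right [of \<alpha>]
      source.corner_bottom_left [of \<alpha>] source.corner_bottom_right [of \<alpha>] by simp_all
  have [simp]: "X \<in> Sqr K" "top_edge K X = hor_id K x" "left_edge K X = i" "right_edge K X = f \<circ>\<^sub>v\<^bsub>K\<^esub> i" "bottom_edge K X = f'"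
    unfolding X_def by (simp_all flip: d)
  have [simp]: "Y \<in> Sqr K" "top_edge K Y = g'" "left_edge K Y = m \<circ>\<^sub>v\<^bsub>K\<^esub> g" "right_edge K Y = m" "bottom_edge K Y = hor_id K y"
    unfolding Y_def by (simp_all flip: d)
  have I: "cpn_ver (induced_companion K L F C) = on_ver F f" "cpn_hor (induced_companion K L F C) = on_hor F f'"
    "cpn_ver (induced_companion K L F D) = on_ver F g" "cpn_hor (induced_companion K L F D) = on_hor F g'"
    by (simp_all add: induced_companion_def Let_def d)
  have [simp]: "\<Psi> \<in> Sqr L" "top_edge L \<Psi> = hor_id L (on_obj F (ver_dom K f))" "left_edge L \<Psi> = ver_id L (on_obj F (ver_dom K f))"
      "right_edge L \<Psi> = on_ver F f" "bottom_edge L \<Psi> = on_hor F f'"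
    using target.companion_pair_simps [OF ind(1)] by (simp_all add: I flip: \<Psi>_def)
  have [simp]: "\<Phi> \<in> Sqr L" "top_edge L \<Phi> = on_hor F g'" "left_edge L \<Phi> = on_ver F g"
      "right_edge L \<Phi> = ver_id L (on_obj F (ver_cod K g))" "bottom_edge L \<Phi> = hor_id L (on_obj F (ver_cod K g))"
    using target.companion_pair_simps [OF ind(2)] by (simp_all add: I flip: \<Phi>_def)
  have W: "on_sqr F X \<ast>\<^sub>v vinv L (hglob_id F x) = (\<Psi> \<ast>\<^sub>v sq_ver L (on_ver F i)) \<ast>\<^sub>h vglob_comp F f i"
    "hglob_id F y \<ast>\<^sub>v on_sqr F Y = hinv L (vglob_comp F m g) \<ast>\<^sub>h (sq_ver L (on_ver F m) \<ast>\<^sub>v \<Phi>)"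
    unfolding X_def Y_def \<Psi>_def \<Phi>_def
    by (rule on_sqr_psi_whisker on_sqr_phi_whisker; simp add: d(1,3))+
  have "hglob_comp F n f' \<ast>\<^sub>v on_sqr F \<beta> \<ast>\<^sub>v vinv L (hglob_comp F g' j)
      = hglob_comp F n f' \<ast>\<^sub>v (on_sqr F \<beta> \<ast>\<^sub>v vinv L (hglob_comp F g' j))"
    by (simp add: target.vcomp_assoc)
  \<comment> \<open>\<open>Y\<close> is split off first, with \<open>X\<close> and \<alpha> kept
    together as one square; the top of that square is \<open>j\<close> because the top of
    \<open>X\<close> is an identity.\<close>
  also have "on_sqr F \<beta> \<ast>\<^sub>v vinv L (hglob_comp F g' j)
      = on_sqr F (X \<ast>\<^sub>h\<^bsub>K\<^esub> \<alpha>) \<ast>\<^sub>h (hglob_id F y \<ast>\<^sub>v on_sqr F Y)"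
    unfolding \<beta> using on_sqr_hcomp_unit_bottom [of "X \<ast>\<^sub>h\<^bsub>K\<^esub> \<alpha>" Y y] by simp
  \<comment> \<open>The identity square below the second column confines \<open>F_{nf'}\<close> to
    the first, where it meets the image of \<open>X\<close> and \<alpha>.\<close>
  also have "hglob_comp F n f' \<ast>\<^sub>v \<dots>
      = (hglob_comp F n f' \<ast>\<^sub>h sq_hor L (hor_id L (on_obj F y))) \<ast>\<^sub>v \<dots>"
    by simp
  also have "\<dots> = (hglob_comp F n f' \<ast>\<^sub>v on_sqr F (X \<ast>\<^sub>h\<^bsub>K\<^esub> \<alpha>)) \<ast>\<^sub>h (hglob_id F y \<ast>\<^sub>v on_sqr F Y)"
    by (simp add: target.interchange del: target.hcomp_sq_hor_id)
  also have "hglob_comp F n f' \<ast>\<^sub>v on_sqr F (X \<ast>\<^sub>h\<^bsub>K\<^esub> \<alpha>) = (on_sqr F X \<ast>\<^sub>v vinv L (hglob_id F x)) \<ast>\<^sub>h on_sqr F \<alpha>"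
    using on_sqr_hcomp_unit_top [of \<alpha> X x] by simp
  finally have "hglob_comp F n f' \<ast>\<^sub>v on_sqr F \<beta> \<ast>\<^sub>v vinv L (hglob_comp F g' j)
      = (\<Psi> \<ast>\<^sub>v sq_ver L (on_ver F i))
        \<ast>\<^sub>h (vglob_comp F f i \<ast>\<^sub>h on_sqr F \<alpha> \<ast>\<^sub>h hinv L (vglob_comp F m g))
        \<ast>\<^sub>h (sq_ver L (on_ver F m) \<ast>\<^sub>v \<Phi>)"
    unfolding W by (simp add: target.hcomp_assoc)
  then show ?thesis
    unfolding companion_mates_def Let_def square_def I f_def [symmetric] f'_def [symmetric] g_def [symmetric] g'_def [symmetric]
      \<Phi>_def [symmetric] \<Psi>_def [symmetric]
    by simp
qed

end

section \<open>Horizontal reversal and conjunctions\<close>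

definition hor_op :: "('o, 'v, 'h, 's) dcat \<Rightarrow> ('o, 'v, 'h, 's) dcat" where
  "hor_op K = K\<lparr>hor_dom := hor_cod K, hor_cod := hor_dom K, hor_comp := \<lambda>g f. f \<circ>\<^sub>h\<^bsub>K\<^esub> g,
     left_edge := right_edge K, right_edge := left_edge K, sq_hcomp := \<lambda>\<alpha> \<beta>. \<beta> \<ast>\<^sub>h\<^bsub>K\<^esub> \<alpha>\<rparr>"

lemma hor_op_simps [simp]:
  "Obj (hor_op K) = Obj K" "Ver (hor_op K) = Ver K" "Hor (hor_op K) = Hor K" "Sqr (hor_op K) = Sqr K"
  "ver_dom (hor_op K) = ver_dom K" "ver_cod (hor_op K) = ver_cod K"
  "hor_dom (hor_op K) = hor_cod K" "hor_cod (hor_op K) = hor_dom K"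
  "ver_id (hor_op K) = ver_id K" "hor_id (hor_op K) = hor_id K"
  "ver_comp (hor_op K) = ver_comp K" "hor_comp (hor_op K) = (\<lambda>g f. f \<circ>\<^sub>h\<^bsub>K\<^esub> g)"
  "top_edge (hor_op K) = top_edge K" "bottom_edge (hor_op K) = bottom_edge K"
  "left_edge (hor_op K) = right_edge K" "right_edge (hor_op K) = left_edge K"
  "sq_ver (hor_op K) = sq_ver K" "sq_hor (hor_op K) = sq_hor K"
  "sq_hcomp (hor_op K) = (\<lambda>\<alpha> \<beta>. \<beta> \<ast>\<^sub>h\<^bsub>K\<^esub> \<alpha>)" "sq_vcomp (hor_op K) = sq_vcomp K"
  by (simp_all add: hor_op_def)

lemma category_op:
  assumes "category Ob Arr dm cd idn cmp"
  shows "category Ob Arr cd dm idn (\<lambda>y x. cmp x y)"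
proof -
  interpret category Ob Arr dm cd idn cmp by fact
  show ?thesis
    by unfold_locales
      (simp_all add: dm_closed cd_closed idn_closed dm_idn cd_idn cmp_closed dm_cmp cd_cmp
        cmp_idn_right cmp_idn_left cmp_assoc)
qed

lemma double_category_hor_op:
  assumes "double_category K"
  shows "double_category (hor_op K)"
proof -
  interpret double_category K by fact
  show ?thesis
  proof (rule double_category.intro, goal_cases)
    case 2 show ?case using category_op [OF hor_category] by simp
  next
    case 3 show ?case using category_op [OF sq_hcomp_category] by simp
  qed (simp_all add: ver_category sq_vcomp_category corner_top_left corner_top_right
      corner_bottom_left corner_bottom_right sq_ver_comp sq_hor_comp interchange)
qed

lemma square_hor_op [simp]: "square (hor_op K) \<alpha> t l r b \<longleftrightarrow> square K \<alpha> t r l b"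
  by (auto simp: square_def)

lemma globular_hor_op [simp]:
  "h_globular (hor_op K) = h_globular K" "v_globular (hor_op K) = v_globular K"
  by (auto simp: h_globular_def v_globular_def fun_eq_iff)

lemma inverse_hor_op [simp]:
  "is_vinv (hor_op K) = is_vinv K" "is_hinv (hor_op K) = is_hinv K"
  "vinv (hor_op K) = vinv K" "hinv (hor_op K) = hinv K"
proof -
  show 1: "is_vinv (hor_op K) = is_vinv K" "is_hinv (hor_op K) = is_hinv K"
    by (auto simp: is_vinv_def is_hinv_def fun_eq_iff)
  show "vinv (hor_op K) = vinv K" "hinv (hor_op K) = hinv K"
    by (simp_all add: vinv_def hinv_def fun_eq_iff 1)
qed

text \<open>
  Reversal exchanges the sides of a v-globular square, so the comparison squares \<open>F^a\<close> and \<open>F^{gf}\<close>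
  have to be replaced by their inverses.
\<close>

definition dpfun_hor_op ::
  "('o2, 'v2, 'h2, 's2) dcat \<Rightarrow> ('o1, 'v1, 'h1, 's1, 'o2, 'v2, 'h2, 's2) dpfun
    \<Rightarrow> ('o1, 'v1, 'h1, 's1, 'o2, 'v2, 'h2, 's2) dpfun" where
  "dpfun_hor_op L F = F\<lparr>vglob_id := \<lambda>a. hinv L (vglob_id F a),
     vglob_comp := \<lambda>v u. hinv L (vglob_comp F v u), hglob_comp := \<lambda>k h. hglob_comp F h k\<rparr>"

lemma dpfun_hor_op_simps [simp]:
  "on_obj (dpfun_hor_op L F) = on_obj F" "on_ver (dpfun_hor_op L F) = on_ver F"
  "on_hor (dpfun_hor_op L F) = on_hor F" "on_sqr (dpfun_hor_op L F) = on_sqr F"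
  "hglob_id (dpfun_hor_op L F) = hglob_id F"
  "vglob_id (dpfun_hor_op L F) a = hinv L (vglob_id F a)"
  "vglob_comp (dpfun_hor_op L F) v u = hinv L (vglob_comp F v u)"
  "hglob_comp (dpfun_hor_op L F) k h = hglob_comp F h k"
  by (simp_all add: dpfun_hor_op_def)

section \<open>The horizontally reversed double pseudofunctor\<close>

context double_pseudofunctor
begin

text \<open>Both sides are horizontal inverses of the same square, namely of the two equal
  composites in vertical associativity coherence. The law for the reversed comparison squares thus
  follows from uniqueness of inverses.\<close>

lemma hinv_coherence_assoc:
  assumes "u \<in> Ver K" "v \<in> Ver K" "w \<in> Ver K" "ver_cod K u = ver_dom K v" "ver_cod K v = ver_dom K w"
  shows "hinv L (vglob_comp F w (v \<circ>\<^sub>v\<^bsub>K\<^esub> u)) \<ast>\<^sub>h (sq_ver L (on_ver F w) \<ast>\<^sub>v hinv L (vglob_comp F v u))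
    = hinv L (vglob_comp F (w \<circ>\<^sub>v\<^bsub>K\<^esub> v) u) \<ast>\<^sub>h (hinv L (vglob_comp F w v) \<ast>\<^sub>v sq_ver L (on_ver F u))"
proof (rule target.is_hinv_unique)
  note [simp] = assms
  show "is_hinv L ((sq_ver L (on_ver F w) \<ast>\<^sub>v vglob_comp F v u) \<ast>\<^sub>h vglob_comp F w (v \<circ>\<^sub>v\<^bsub>K\<^esub> u))
      (hinv L (vglob_comp F w (v \<circ>\<^sub>v\<^bsub>K\<^esub> u)) \<ast>\<^sub>h (sq_ver L (on_ver F w) \<ast>\<^sub>v hinv L (vglob_comp F v u)))"
    by (intro target.is_hinv_hcomp target.is_hinv_vcomp target.is_hinv_sq_ver is_hinv_vglob_comp) simp_all
  show "is_hinv L ((sq_ver L (on_ver F w) \<ast>\<^sub>v vglob_comp F v u) \<ast>\<^sub>h vglob_comp F w (v \<circ>\<^sub>v\<^bsub>K\<^esub> u))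
      (hinv L (vglob_comp F (w \<circ>\<^sub>v\<^bsub>K\<^esub> v) u) \<ast>\<^sub>h (hinv L (vglob_comp F w v) \<ast>\<^sub>v sq_ver L (on_ver F u)))"
    unfolding ver_coherence_assoc [OF assms]
    by (intro target.is_hinv_hcomp target.is_hinv_vcomp target.is_hinv_sq_ver is_hinv_vglob_comp)
      (simp_all add: source.ver.cmp_assoc target.ver.cmp_assoc)
qed

lemma hinv_coherence_id_left:
  assumes "u \<in> Ver K"
  shows "hinv L (vglob_comp F (ver_id K (ver_cod K u)) u)
      \<ast>\<^sub>h (hinv L (vglob_id F (ver_cod K u)) \<ast>\<^sub>v sq_ver L (on_ver F u)) = sq_ver L (on_ver F u)"
proof (rule target.is_hinv_unique)
  note [simp] = assms
  show "is_hinv L ((vglob_id F (ver_cod K u) \<ast>\<^sub>v sq_ver L (on_ver F u))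
        \<ast>\<^sub>h vglob_comp F (ver_id K (ver_cod K u)) u)
      (hinv L (vglob_comp F (ver_id K (ver_cod K u)) u)
        \<ast>\<^sub>h (hinv L (vglob_id F (ver_cod K u)) \<ast>\<^sub>v sq_ver L (on_ver F u)))"
    by (intro target.is_hinv_hcomp target.is_hinv_vcomp target.is_hinv_sq_ver is_hinv_vglob_comp
        is_hinv_vglob_id) simp_all
qed (simp add: ver_coherence_id_left assms target.is_hinv_sq_ver)

lemma hinv_coherence_id_right:
  assumes "u \<in> Ver K"
  shows "hinv L (vglob_comp F u (ver_id K (ver_dom K u)))
      \<ast>\<^sub>h (sq_ver L (on_ver F u) \<ast>\<^sub>v hinv L (vglob_id F (ver_dom K u))) = sq_ver L (on_ver F u)"
proof (rule target.is_hinv_unique)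
  note [simp] = assms
  show "is_hinv L ((sq_ver L (on_ver F u) \<ast>\<^sub>v vglob_id F (ver_dom K u))
        \<ast>\<^sub>h vglob_comp F u (ver_id K (ver_dom K u)))
      (hinv L (vglob_comp F u (ver_id K (ver_dom K u)))
        \<ast>\<^sub>h (sq_ver L (on_ver F u) \<ast>\<^sub>v hinv L (vglob_id F (ver_dom K u))))"
    by (intro target.is_hinv_hcomp target.is_hinv_vcomp target.is_hinv_sq_ver is_hinv_vglob_comp
        is_hinv_vglob_id) simp_all
qed (simp add: ver_coherence_id_right assms target.is_hinv_sq_ver)

text \<open>Vertical naturality is composed with the inverse of one comparison square on each side,
  which moves both to the opposite sides as reversal requires.\<close>

lemma hinv_naturality_vcomp:
  assumes "\<alpha> \<in> Sqr K" "\<beta> \<in> Sqr K" "bottom_edge K \<alpha> = top_edge K \<beta>"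
  shows "on_sqr F (\<beta> \<ast>\<^sub>v\<^bsub>K\<^esub> \<alpha>) \<ast>\<^sub>h hinv L (vglob_comp F (right_edge K \<beta>) (right_edge K \<alpha>))
    = hinv L (vglob_comp F (left_edge K \<beta>) (left_edge K \<alpha>)) \<ast>\<^sub>h (on_sqr F \<beta> \<ast>\<^sub>v on_sqr F \<alpha>)"
proof -
  let ?l = "vglob_comp F (left_edge K \<beta>) (left_edge K \<alpha>)"
  let ?r = "vglob_comp F (right_edge K \<beta>) (right_edge K \<alpha>)"
  have c: "ver_cod K (left_edge K \<alpha>) = ver_dom K (left_edge K \<beta>)"
    "ver_cod K (right_edge K \<alpha>) = ver_dom K (right_edge K \<beta>)"
    using assms by (metis source.corner_bottom_left source.corner_top_left
        source.corner_bottom_right source.corner_top_right)+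
  have "hinv L ?l \<ast>\<^sub>h (on_sqr F \<beta> \<ast>\<^sub>v on_sqr F \<alpha>)
      = hinv L ?l \<ast>\<^sub>h (((on_sqr F \<beta> \<ast>\<^sub>v on_sqr F \<alpha>) \<ast>\<^sub>h ?r) \<ast>\<^sub>h hinv L ?r)"
    using assms c by (simp add: target.hcomp_assoc)
  also have "\<dots> = ((hinv L ?l \<ast>\<^sub>h ?l) \<ast>\<^sub>h on_sqr F (\<beta> \<ast>\<^sub>v\<^bsub>K\<^esub> \<alpha>)) \<ast>\<^sub>h hinv L ?r"
    using assms c unfolding naturality_vcomp [OF assms, symmetric]
    by (simp add: target.hcomp_assoc del: hinv_vglob_comp(7) target.units)
  finally show ?thesis
    using assms c by simp
qed

text \<open>A left-nested composite in the reversed double category is right-nested in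
  \<open>L\<close>, so the law only has to be rebracketed.\<close>

lemma hinv_naturality_sq_hor:
  assumes "f \<in> Hor K"
  shows "vglob_id F (hor_dom K f)
      \<ast>\<^sub>h (on_sqr F (sq_hor K f) \<ast>\<^sub>h hinv L (vglob_id F (hor_cod K f))) = sq_hor L (on_hor F f)"
  using assms naturality_sq_hor [OF assms] by (simp add: target.hcomp_assoc)

lemma hinv_hinv [simp]:
  "a \<in> Obj K \<Longrightarrow> hinv L (hinv L (vglob_id F a)) = vglob_id F a"
  "\<lbrakk>u \<in> Ver K; v \<in> Ver K; ver_cod K u = ver_dom K v\<rbrakk>
    \<Longrightarrow> hinv L (hinv L (vglob_comp F v u)) = vglob_comp F v u"
  by (simp_all add: target.hinv_eqI [OF target.is_hinv_sym] is_hinv_vglob_id is_hinv_vglob_comp)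

text \<open>The horizontal axioms hold with their arguments in reverse order, which exchanges the
  two unit laws. The axioms involving \<open>F^a\<close> and \<open>F^{gf}\<close> hold in the
  inverted forms proved above.\<close>

lemma double_pseudofunctor_hor_op:
  "double_pseudofunctor (hor_op K) (hor_op L) (dpfun_hor_op L F)"
proof (intro double_pseudofunctor.intro double_pseudofunctor_axioms.intro, goal_cases)
  case (10 \<alpha>) then show ?case using on_sqr_square by simp
next
  case (11 a) then show ?case using hglob_id by simp
next
  case (12 a)
  then have a: "a \<in> Obj K" by simp
  have "\<exists>\<gamma>. is_hinv L (hinv L (vglob_id F a)) \<gamma>"
    using target.is_hinv_sym [OF is_hinv_vglob_id [OF a]] by blast
  then show ?case using a by (simp add: v_globular_def)
next
  case (13 u v)
  then have uv: "u \<in> Ver K" "v \<in> Ver K" "ver_cod K u = ver_dom K v" by simp_all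
  have "\<exists>\<gamma>. is_hinv L (hinv L (vglob_comp F v u)) \<gamma>"
    using target.is_hinv_sym [OF is_hinv_vglob_comp [OF uv]] by blast
  then show ?case using uv by (simp add: v_globular_def)
next
  case (14 h k) then show ?case using hglob_comp by simp
next
  case (15 u v w) then show ?case using hinv_coherence_assoc [of u v w] by simp
next
  case (16 u) then show ?case using hinv_coherence_id_left [of u] by simp
next
  case (17 u) then show ?case using hinv_coherence_id_right [of u] by simp
next
  case (18 f g h) then show ?case using hor_coherence_assoc [of h g f] by simp
next
  case (19 f) then show ?case using hor_coherence_id_left [of f] by simp
next
  case (20 f) then show ?case using hor_coherence_id_right [of f] by simp
next
  case (21 \<alpha> \<beta>) then show ?case using naturality_hcomp [of \<beta> \<alpha>] by simp
next
  case (22 u) then show ?case using naturality_sq_ver [of u] by simp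
next
  case (23 \<alpha> \<beta>) then show ?case using hinv_naturality_vcomp [of \<alpha> \<beta>] by simp
next
  case (24 f) then show ?case using hinv_naturality_sq_hor [of f] by simp
qed (simp_all add: double_category_hor_op source.double_category_axioms target.double_category_axioms)

end

section \<open>Conjunctions as companion pairs under reversal\<close>

definition conjunction_companion :: "('v, 'h, 's) conjunction \<Rightarrow> ('v, 'h, 's) companion" where
  "conjunction_companion C =
     \<lparr>cpn_ver = cnj_ver C, cpn_hor = cnj_hor C, cpn_phi = cnj_counit C, cpn_psi = cnj_unit C\<rparr>"

lemma conjunction_companion_simps [simp]:
  "cpn_ver (conjunction_companion C) = cnj_ver C" "cpn_hor (conjunction_companion C) = cnj_hor C"
  "cpn_phi (conjunction_companion C) = cnj_counit C" "cpn_psi (conjunction_companion C) = cnj_unit C"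
  by (simp_all add: conjunction_companion_def)

lemma companion_pair_hor_op:
  "companion_pair (hor_op K) (conjunction_companion C) \<longleftrightarrow> conjunction_pair K C"
  by (auto simp: companion_pair_def conjunction_pair_def Let_def)

text \<open>The reversed pasting formula is the formula for conjunctions with the three squares
  bracketed to the right. Hence the two differ only by associativity, available from the typing
  conditions that both relations contain.\<close>

lemma (in double_category) companion_mates_hor_op:
  "companion_mates (hor_op K) (conjunction_companion C) (conjunction_companion D) j i m n \<alpha> \<beta>
    \<longleftrightarrow> conjunction_mates K C D i j m n \<alpha> \<beta>"
proof -
  have "(sq_ver K m \<ast>\<^sub>v cnj_counit D) \<ast>\<^sub>h \<alpha> \<ast>\<^sub>h (cnj_unit C \<ast>\<^sub>v sq_ver K j)
      = (sq_ver K m \<ast>\<^sub>v cnj_counit D) \<ast>\<^sub>h (\<alpha> \<ast>\<^sub>h (cnj_unit C \<ast>\<^sub>v sq_ver K j))"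
    if "conjunction_pair K C" "conjunction_pair K D" "j \<in> Ver K" "ver_cod K j = ver_dom K (cnj_ver C)"
      "m \<in> Ver K" "ver_dom K m = ver_cod K (cnj_ver D)"
      "square K \<alpha> i (m \<circ>\<^sub>v cnj_ver D) (cnj_ver C \<circ>\<^sub>v j) n"
    using that by (intro hcomp_assoc) (simp_all add: conjunction_pair_def square_def Let_def)
  then show ?thesis
    unfolding companion_mates_def conjunction_mates_def Let_def companion_pair_hor_op
    by auto
qed

section \<open>Preservation of mates for conjunctions\<close>

context double_pseudofunctor
begin

text \<open>The reversed comparison squares are inverses, so the induced \<phi> contains a double
  inverse of \<open>F^b\<close>, which cancels. The hypothesis ensures that \<open>a\<close> and
  \<open>b\<close> are objects, as this cancellation requires.\<close>

lemma induced_companion_hor_op: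
  assumes "conjunction_pair K C"
  shows "induced_companion (hor_op K) (hor_op L) (dpfun_hor_op L F) (conjunction_companion C)
    = conjunction_companion (induced_conjunction K L F C)"
  using assms by (simp add: induced_companion_def induced_conjunction_def conjunction_companion_def
      Let_def conjunction_pair_def)

lemma conjunction_mates_preserved:
  assumes "conjunction_mates K C D i j m n \<alpha> \<beta>"
  shows "conjunction_mates L (induced_conjunction K L F C) (induced_conjunction K L F D)
      (on_hor F i) (on_ver F j) (on_ver F m) (on_hor F n)
      (vglob_comp F m (cnj_ver D) \<ast>\<^sub>h on_sqr F \<alpha> \<ast>\<^sub>h hinv L (vglob_comp F (cnj_ver C) j))
      (hglob_comp F (cnj_hor C) n \<ast>\<^sub>v on_sqr F \<beta> \<ast>\<^sub>v vinv L (hglob_comp F i (cnj_hor D)))"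
proof -
  interpret op: double_pseudofunctor "hor_op K" "hor_op L" "dpfun_hor_op L F"
    by (rule double_pseudofunctor_hor_op)
  have C: "conjunction_pair K C" "conjunction_pair K D"
    "cnj_ver C \<in> Ver K" "cnj_ver D \<in> Ver K" "j \<in> Ver K" "ver_cod K j = ver_dom K (cnj_ver C)"
    "m \<in> Ver K" "ver_dom K m = ver_cod K (cnj_ver D)" "\<alpha> \<in> Sqr K"
    "left_edge K \<alpha> = m \<circ>\<^sub>v\<^bsub>K\<^esub> cnj_ver D" "right_edge K \<alpha> = cnj_ver C \<circ>\<^sub>v\<^bsub>K\<^esub> j"
    using assms unfolding conjunction_mates_def conjunction_pair_def square_def Let_def by blast+
  have "companion_mates (hor_op K) (conjunction_companion C) (conjunction_companion D) j i m n \<alpha> \<beta>"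
    using assms by (simp add: source.companion_mates_hor_op)
  note op.companion_mates_preserved [OF this]
  \<comment> \<open>In the result for the reversed functor the comparison at \<open>m\<close> is
    doubly inverted and the composite, read in \<open>L\<close>, is bracketed to the right. Once the
    double inverse is cancelled, only this rebracketing remains.\<close>
  moreover have "vglob_comp F m (cnj_ver D) \<ast>\<^sub>h (on_sqr F \<alpha> \<ast>\<^sub>h hinv L (vglob_comp F (cnj_ver C) j))
      = vglob_comp F m (cnj_ver D) \<ast>\<^sub>h on_sqr F \<alpha> \<ast>\<^sub>h hinv L (vglob_comp F (cnj_ver C) j)"
    using C by (intro target.hcomp_assoc [symmetric]) simp_all
  ultimately show ?thesis
    using C by (simp add: induced_companion_hor_op target.companion_mates_hor_op)
qed

end

theorem proposition6p9:
  fixes K :: "('o1, 'v1, 'h1, 's1) dcat"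
    and L :: "('o2, 'v2, 'h2, 's2) dcat"
    and F :: "('o1, 'v1, 'h1, 's1, 'o2, 'v2, 'h2, 's2) dpfun"
  assumes "double_pseudofunctor K L F"
  shows
    "(\<forall>C D i j m n \<alpha> \<beta>.
        companion_pair K C \<longrightarrow> companion_pair K D \<longrightarrow>
        companion_mates K C D i j m n \<alpha> \<beta> \<longrightarrow>
        companion_mates L (induced_companion K L F C) (induced_companion K L F D)
          (on_ver F i) (on_hor F j) (on_ver F m) (on_hor F n)
          (vglob_comp F (cpn_ver C) i \<ast>\<^sub>h\<^bsub>L\<^esub> on_sqr F \<alpha> \<ast>\<^sub>h\<^bsub>L\<^esub> hinv L (vglob_comp F m (cpn_ver D)))
          (hglob_comp F n (cpn_hor C) \<ast>\<^sub>v\<^bsub>L\<^esub> on_sqr F \<beta> \<ast>\<^sub>v\<^bsub>L\<^esub> vinv L (hglob_comp F (cpn_hor D) j)))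
     \<and>
     (\<forall>C D i j m n \<alpha> \<beta>.
        conjunction_pair K C \<longrightarrow> conjunction_pair K D \<longrightarrow>
        conjunction_mates K C D i j m n \<alpha> \<beta> \<longrightarrow>
        conjunction_mates L (induced_conjunction K L F C) (induced_conjunction K L F D)
          (on_hor F i) (on_ver F j) (on_ver F m) (on_hor F n)
          (vglob_comp F m (cnj_ver D) \<ast>\<^sub>h\<^bsub>L\<^esub> on_sqr F \<alpha> \<ast>\<^sub>h\<^bsub>L\<^esub> hinv L (vglob_comp F (cnj_ver C) j))
          (hglob_comp F (cnj_hor C) n \<ast>\<^sub>v\<^bsub>L\<^esub> on_sqr F \<beta> \<ast>\<^sub>v\<^bsub>L\<^esub> vinv L (hglob_comp F i (cnj_hor D))))"
proof -
  interpret double_pseudofunctor K L F by fact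
  show ?thesis
    using companion_mates_preserved conjunction_mates_preserved by blast
qed

end
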